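(* Suppose $k\ge 4$ is even. Let $L$ be an irredundant $2\times k$ linear system with girth $s(L)=k-1$. Then there exists $p_L$ such that $L$ is uncommon over $\mathbb{F}_p$ for all primes $p\ge p_L$.
   Context: An $m\times k$ linear system $L$ is a collection of $m$ homogeneous linear equations in $k$ variables with integer coefficients, identified with its coefficient matrix $L\in\mathbb{Z}^{m\times k}$ (equations $L\mathbf{x}=0$). Row spans are taken over $\mathbb{Q}$. $L$ is irredundant if: (1) its rows are linearly independent; (2) no column of $L$ is zero; (3) the row span of $L$ contains no vector having one entry $1$, one entry $-1$ and all other entries $0$. The girth $s(L)$ is the minimum size of the support of a nonzero vector in the row span of $L$. For a prime $p$, $n\in\mathbb{N}$ and $f:\mathbb{F}_p^n\to\mathbb{R}$, let $t_L(f)=\mathbb{E}_{\mathbf{x}\in(\mathbb{F}_p^n)^k:\,L\mathbf{x}=0}\,f(x_1)\cdots f(x_k)$ (average over all solutions). An irredundant $m\times k$ system $L$ is common over $\mathbb{F}_p$ if for all $n\in\mathbb{N}$ and all $f:\mathbb{F}_p^n\to[0,1]$ one has $t_L(f)+t_L(1-f)\ge 2^{1-k}$; otherwise $L$ is uncommon over $\mathbb{F}_p$. *)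

theory Defs
  imports
    "Jordan_Normal_Form.VS_Connect"
    "HOL-Number_Theory.Number_Theory"
begin

text \<open>
  An \<open>m \<times> k\<close> linear system is an integer matrix \<open>L \<in> carrier_mat m k\<close>; rows and columns are
  indexed from 0.
\<close>

definition rat_mat :: "int mat \<Rightarrow> rat mat" where
  "rat_mat L = map_mat rat_of_int L"

definition row_span :: "int mat \<Rightarrow> rat vec set" where
  "row_span L = vec_space.row_space (dim_col L) (rat_mat L)"

text \<open>
  \<open>lin_dep\<close> is a predicate on sets, which does not see repeated rows; hence \<open>distinct\<close>.
\<close>

definition rows_lin_indpt :: "int mat \<Rightarrow> bool" where
  "rows_lin_indpt L \<longleftrightarrow>
     distinct (rows (rat_mat L)) \<and>
     \<not> module.lin_dep class_ring (module_vec TYPE(rat) (dim_col L)) (set (rows (rat_mat L)))"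

definition irredundant :: "int mat \<Rightarrow> bool" where
  "irredundant L \<longleftrightarrow>
     rows_lin_indpt L \<and>
     (\<forall>j<dim_col L. col L j \<noteq> 0\<^sub>v (dim_row L)) \<and>
     \<not> (\<exists>a<dim_col L. \<exists>b<dim_col L. a \<noteq> b \<and>
          unit_vec (dim_col L) a - unit_vec (dim_col L) b \<in> row_span L)"

definition supp_vec :: "rat vec \<Rightarrow> nat set" where
  "supp_vec v = {j. j < dim_vec v \<and> v $ j \<noteq> 0}"

text \<open>
  For a nonzero \<open>L\<close> the infimum is over a nonempty set of naturals, so it is a minimum.
\<close>

definition girth :: "int mat \<Rightarrow> nat" where
  "girth L = Inf {card (supp_vec v) | v. v \<in> row_span L \<and> v \<noteq> 0\<^sub>v (dim_col L)}"

text \<open>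
  \<open>\<bbbF>\<^sub>p\<close> is represented by its residues \<open>0, \<dots>, p - 1\<close> and \<open>\<bbbF>\<^sub>p\<^sup>n\<close> by extensional functions on
  \<open>{..<n}\<close>, since \<open>p\<close> and \<open>n\<close> are quantified inside the definitions and statements.
\<close>

definition Fp_space :: "nat \<Rightarrow> nat \<Rightarrow> (nat \<Rightarrow> int) set" where
  "Fp_space p n = {..<n} \<rightarrow>\<^sub>E {0..<int p}"

text \<open>
  \<open>x j\<close> is the \<open>j\<close>-th vector of a solution and \<open>x j c\<close> its \<open>c\<close>-th coordinate; the equations hold
  in \<open>\<bbbF>\<^sub>p\<^sup>n\<close>, i.e. coordinatewise modulo \<open>p\<close>.
\<close>

definition solutions :: "nat \<Rightarrow> nat \<Rightarrow> int mat \<Rightarrow> (nat \<Rightarrow> nat \<Rightarrow> int) set" where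
  "solutions p n L =
     {x \<in> {..<dim_col L} \<rightarrow>\<^sub>E Fp_space p n.
        \<forall>i<dim_row L. \<forall>c<n. [(\<Sum>j<dim_col L. L $$ (i, j) * x j c) = 0] (mod int p)}"

definition sol_density :: "nat \<Rightarrow> nat \<Rightarrow> int mat \<Rightarrow> ((nat \<Rightarrow> int) \<Rightarrow> real) \<Rightarrow> real" where
  "sol_density p n L f =
     (\<Sum>x\<in>solutions p n L. \<Prod>j<dim_col L. f (x j)) / real (card (solutions p n L))"

text \<open>
  As usual, common and uncommon are meant for irredundant \<open>L\<close> and prime \<open>p\<close>.  Allowing \<open>n = 0\<close>
  is harmless: there the inequality reads \<open>a\<^sup>k + (1 - a)\<^sup>k \<ge> 2\<^sup>1\<^sup>-\<^sup>k\<close> with \<open>0 \<le> a \<le> 1\<close>, which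
  always holds for \<open>k \<ge> 1\<close>.
\<close>

definition common_over :: "nat \<Rightarrow> int mat \<Rightarrow> bool" where
  "common_over p L \<longleftrightarrow>
     (\<forall>n. \<forall>f \<in> Fp_space p n \<rightarrow> {0..1}.
        sol_density p n L f + sol_density p n L (\<lambda>v. 1 - f v) \<ge> 2 powi (1 - int (dim_col L)))"

definition uncommon_over :: "nat \<Rightarrow> int mat \<Rightarrow> bool" where
  "uncommon_over p L \<longleftrightarrow> \<not> common_over p L"

end

theory Submission
  imports Defs
begin

text \<open>
  Girth \<open>k - 1\<close> means that the columns \<open>v\<^sub>j = (X\<^sub>j, Y\<^sub>j)\<close> are pairwise not parallel.  Write
  \<open>f = 1/2 + \<eta> g\<close>.  In the expansion of \<open>t\<^sub>L(f) + t\<^sub>L(1 - f)\<close> the odd terms cancel, and an even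
  proper nonempty set of factors of mean zero misses two variables, so its average vanishes; what
  remains is \<open>2\<^sup>1\<^sup>-\<^sup>k + 2 \<eta>\<^sup>k t\<^sub>L(g)\<close>.  Hence it suffices to find \<open>g\<close> of mean zero with \<open>t\<^sub>L(g) < 0\<close>.

  Take \<open>g\<close> on \<open>\<bbbF>\<^sub>p\<^sup>k\<close> with Fourier support at the points \<open>\<plusminus>(v\<^sub>i, s)\<close>, \<open>s \<in> \<bbbF>\<^sub>p\<^sup>d\<close>, \<open>d = k - 2\<close>, with
  coefficients \<open>z\<^sub>i e(\<plusminus>c r\<^sub>i s\<^sub>1 \<cdots> s\<^sub>d)\<close>, where \<open>z\<^sub>0 = -1\<close>, all other \<open>z\<^sub>i = 1\<close>, and the weights
  \<open>r\<^sub>i = 1 / \<Prod>\<^sub>j det (v\<^sub>j, v\<^sub>i)\<close> (up to a common factor) annihilate all products of \<open>d\<close> linear forms.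
  Averaging over \<open>c\<close> turns \<open>t\<^sub>L(g)\<close> into a count of the tuples of frequencies that lie in the row
  space of \<open>L\<close> and have total phase zero.  In such a tuple the indices \<open>i\<close> either form a
  permutation, and the tuple counts with sign \<open>\<Prod> z\<^sub>i = -1\<close>, or are constant, and it counts with
  sign \<open>+1\<close>.  The identity permutation alone gives \<open>p\<^sup>2\<^sup>d\<close> tuples.  In the constant case some linear
  form takes values \<open>\<epsilon>\<^sub>j = \<plusminus>1\<close> at all \<open>v\<^sub>j\<close>, and the tuples are the zeros of a multilinear form in
  \<open>d\<close> arguments from \<open>\<bbbF>\<^sub>p\<^sup>2\<close>, which is nonzero for large \<open>p\<close>; there are only \<open>O(p\<^sup>2\<^sup>d\<^sup>-\<^sup>1)\<close> of them.
\<close>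

section \<open>Additive characters\<close>

definition add_char :: "nat \<Rightarrow> int \<Rightarrow> complex" where
  "add_char p t = cis (2 * pi * real_of_int t / real p)"

lemma add_char_0 [simp]: "add_char p 0 = 1"
  by (simp add: add_char_def)

lemma add_char_add: "add_char p (s + t) = add_char p s * add_char p t"
  by (simp add: add_char_def cis_mult add_divide_distrib distrib_left)

lemma add_char_sum: "add_char p (sum f A) = (\<Prod>a\<in>A. add_char p (f a))"
  by (induction A rule: infinite_finite_induct) (auto simp: add_char_add)

lemma add_char_uminus_add: "add_char p t + add_char p (- t) = of_real (2 * cos (2 * pi * t / p))"
  by (simp add: add_char_def complex_eq_iff)

lemma add_char_eq_1_iff:
  assumes "p > 0"
  shows "add_char p t = 1 \<longleftrightarrow> int p dvd t"
proof
  assume "add_char p t = 1"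
  then have "cos (2 * pi * t / p) = 1"
    unfolding add_char_def by (metis cis.simps(1) one_complex.simps(1))
  then obtain m :: int where m: "2 * pi * t / p = of_int m * 2 * pi"
    using cos_one_2pi_int by blast
  have "real_of_int t = real_of_int (m * int p)"
    using m assms by (simp add: field_simps)
  then have "t = m * int p" by linarith
  then show "int p dvd t" by simp
next
  assume "int p dvd t"
  then obtain m where m: "t = int p * m" by blast
  have "2 * pi * real_of_int t / real p = 2 * pi * of_int m"
    using assms m by simp
  then show "add_char p t = 1"
    unfolding add_char_def by (simp add: cis_multiple_2pi)
qed

lemma add_char_cong:
  assumes "p > 0" "[s = t] (mod int p)"
  shows "add_char p s = add_char p t"
proof -
  have "add_char p (s - t) = 1"
    using assms by (simp add: add_char_eq_1_iff cong_iff_dvd_diff)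
  then have "add_char p (t + (s - t)) = add_char p t"
    by (simp only: add_char_add) simp
  then show ?thesis by simp
qed

text \<open>Replacing \<open>c\<close> by \<open>c + 1\<close> modulo \<open>p\<close> permutes the
  range of summation and multiplies the sum by \<open>add_char p q\<close>, which differs from 1
  unless \<open>p\<close> divides \<open>q\<close>.\<close>

lemma sum_add_char:
  assumes "p > 0"
  shows "(\<Sum>c\<in>{0..<int p}. add_char p (c * q)) = (if int p dvd q then of_nat p else 0)"
proof (cases "int p dvd q")
  case True
  then have "(\<Sum>c\<in>{0..<int p}. add_char p (c * q)) = (\<Sum>c\<in>{0..<int p}. 1)"
    using assms by (intro sum.cong) (auto simp: add_char_eq_1_iff)
  then show ?thesis using True by simp
next
  case False
  let ?S = "\<Sum>c\<in>{0..<int p}. add_char p (c * q)"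
  have "?S = (\<Sum>c\<in>{0..<int p}. add_char p (((c + 1) mod p) * q))"
    using assms
    by (intro sum.reindex_bij_witness[where i = "\<lambda>c. (c + 1) mod p" and j = "\<lambda>c. (c - 1) mod p"
          and S = "{0..<int p}" and T = "{0..<int p}"])
      (auto simp: mod_simps)
  also have "\<dots> = (\<Sum>c\<in>{0..<int p}. add_char p q * add_char p (c * q))"
  proof (intro sum.cong refl)
    fix c :: int
    have "[((c + 1) mod p) * q = q + c * q] (mod int p)"
      by (simp add: cong_def mod_simps algebra_simps)
    then show "add_char p (((c + 1) mod p) * q) = add_char p q * add_char p (c * q)"
      using add_char_cong[OF assms] by (simp add: add_char_add)
  qed
  also have "\<dots> = add_char p q * ?S"
    by (simp add: sum_distrib_left)
  finally have "?S = 0"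
    using False assms by (simp add: add_char_eq_1_iff)
  then show ?thesis using False by simp
qed

section \<open>Characters on the solution space\<close>

definition det2 :: "(nat \<Rightarrow> int) \<Rightarrow> (nat \<Rightarrow> int) \<Rightarrow> nat \<Rightarrow> nat \<Rightarrow> int" where
  "det2 X Y i j = X i * Y j - X j * Y i"

definition solutions2 ::
  "nat \<Rightarrow> nat \<Rightarrow> nat \<Rightarrow> (nat \<Rightarrow> int) \<Rightarrow> (nat \<Rightarrow> int) \<Rightarrow> (nat \<Rightarrow> nat \<Rightarrow> int) set" where
  "solutions2 p n k X Y = {x \<in> {..<k} \<rightarrow>\<^sub>E Fp_space p n.
     \<forall>c<n. [(\<Sum>j<k. X j * x j c) = 0] (mod int p) \<and> [(\<Sum>j<k. Y j * x j c) = 0] (mod int p)}"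

text \<open>These are the 3x3 minors of the matrix with rows \<open>X\<close>, \<open>Y\<close>,
  \<open>u\<close>. Once some 2x2 minor of \<open>X\<close>, \<open>Y\<close> is invertible modulo
  \<open>p\<close>, their vanishing means that \<open>u\<close> lies in the row space modulo
  \<open>p\<close>, and no coefficients have to be named.\<close>

definition pluecker :: "nat \<Rightarrow> nat \<Rightarrow> (nat \<Rightarrow> int) \<Rightarrow> (nat \<Rightarrow> int) \<Rightarrow> (nat \<Rightarrow> int) \<Rightarrow> bool" where
  "pluecker p k X Y u \<longleftrightarrow> (\<forall>a<k. \<forall>b<k. \<forall>l<k.
     [u a * det2 X Y b l + u b * det2 X Y l a + u l * det2 X Y a b = 0] (mod int p))"

lemma finite_solutions2: "finite (solutions2 p n k X Y)"
  unfolding solutions2_def Fp_space_def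
  by (rule finite_subset[of _ "{..<k} \<rightarrow>\<^sub>E ({..<n} \<rightarrow>\<^sub>E {0..<int p})"]) (auto intro!: finite_PiE)

lemma solutions2_nonempty:
  assumes "p > 0"
  shows "solutions2 p n k X Y \<noteq> {}"
proof -
  have "(\<lambda>j\<in>{..<k}. \<lambda>c\<in>{..<n}. 0) \<in> solutions2 p n k X Y"
    using assms by (auto simp: solutions2_def Fp_space_def)
  then show ?thesis by blast
qed

definition shift_sol ::
    "nat \<Rightarrow> nat \<Rightarrow> nat \<Rightarrow> (nat \<Rightarrow> nat \<Rightarrow> int) \<Rightarrow> (nat \<Rightarrow> nat \<Rightarrow> int) \<Rightarrow> nat \<Rightarrow> nat \<Rightarrow> int" where
  "shift_sol p n k y x = (\<lambda>j\<in>{..<k}. \<lambda>c\<in>{..<n}. (x j c + y j c) mod int p)"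

lemma sum_mod_cong:
  fixes f g w :: "'a \<Rightarrow> int"
  shows "[(\<Sum>j\<in>J. w j * ((f j + g j) mod m)) = (\<Sum>j\<in>J. w j * f j) + (\<Sum>j\<in>J. w j * g j)] (mod m)"
proof -
  have "[(\<Sum>j\<in>J. w j * ((f j + g j) mod m)) = (\<Sum>j\<in>J. w j * (f j + g j))] (mod m)"
    by (intro cong_sum cong_scalar_left) (simp add: cong_def)
  then show ?thesis by (simp add: algebra_simps sum.distrib)
qed

lemma shift_sol_in_solutions2:
  assumes p: "p > 0" and x: "x \<in> solutions2 p n k X Y"
    and y: "\<And>c. c < n \<Longrightarrow> (\<Sum>j<k. X j * y j c) = 0" "\<And>c. c < n \<Longrightarrow> (\<Sum>j<k. Y j * y j c) = 0"
  shows "shift_sol p n k y x \<in> solutions2 p n k X Y"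
proof -
  have "[(\<Sum>j<k. w j * shift_sol p n k y x j c) = 0] (mod int p)"
    if "c < n" "[(\<Sum>j<k. w j * x j c) = 0] (mod int p)" "(\<Sum>j<k. w j * y j c) = 0" for w c
  proof -
    have "(\<Sum>j<k. w j * shift_sol p n k y x j c) = (\<Sum>j<k. w j * ((x j c + y j c) mod int p))"
      using that by (intro sum.cong) (auto simp: shift_sol_def)
    also have "[\<dots> = (\<Sum>j<k. w j * x j c) + (\<Sum>j<k. w j * y j c)] (mod int p)"
      by (rule sum_mod_cong)
    also have "(\<Sum>j<k. w j * x j c) + (\<Sum>j<k. w j * y j c) = (\<Sum>j<k. w j * x j c)"
      using that by simp
    also note that(2)
    finally show ?thesis .
  qed
  then show ?thesis
    using x y p by (auto simp: solutions2_def Fp_space_def) (auto simp: shift_sol_def)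
qed

lemma mod_add_diff_cancel:
  fixes s t m :: int
  assumes "s \<in> {0..<m}"
  shows "((s + t) mod m + - t) mod m = s"
proof -
  have "((s + t) mod m + - t) mod m = ((s + t) + - t) mod m" by (rule mod_add_left_eq)
  also have "(s + t) + - t = s" by simp
  also have "s mod m = s" using assms by (intro mod_pos_pos_trivial) auto
  finally show ?thesis .
qed

lemma shift_sol_uminus:
  assumes "x \<in> solutions2 p n k X Y"
  shows "shift_sol p n k (\<lambda>j c. - y j c) (shift_sol p n k y x) = x"
proof (intro ext)
  fix j c
  have x: "x \<in> {..<k} \<rightarrow>\<^sub>E ({..<n} \<rightarrow>\<^sub>E {0..<int p})"
    using assms unfolding solutions2_def Fp_space_def by simp
  show "shift_sol p n k (\<lambda>j c. - y j c) (shift_sol p n k y x) j c = x j c"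
  proof (cases "j < k")
    case True
    then have xj: "x j \<in> {..<n} \<rightarrow>\<^sub>E {0..<int p}" using x by auto
    show ?thesis
    proof (cases "c < n")
      case c: True
      have "shift_sol p n k (\<lambda>j c. - y j c) (shift_sol p n k y x) j c =
          ((x j c + y j c) mod int p + - y j c) mod int p"
        using True c by (simp only: shift_sol_def restrict_apply lessThan_iff if_True)
      also have "\<dots> = x j c"
        by (rule mod_add_diff_cancel) (use PiE_mem[OF xj, of c] c in simp)
      finally show ?thesis .
    next
      case False
      then show ?thesis using True PiE_arb[OF xj, of c] by (simp add: shift_sol_def)
    qed
  next
    case False
    then show ?thesis using PiE_arb[OF x, of j] by (simp add: shift_sol_def)
  qed
qed

text \<open>The relation on the columns \<open>a\<close>, \<open>b\<close>, \<open>j\<close> writes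
  \<open>det2 X Y a b * u j\<close> as a combination of \<open>X j\<close> and \<open>Y j\<close>
  whose coefficients do not depend on \<open>j\<close>, and the factor is invertible modulo
  \<open>p\<close>.\<close>

lemma solution_annihilates:
  assumes "pluecker p k X Y u" "prime p"
    and D: "a < k" "b < k" "\<not> int p dvd det2 X Y a b"
    and "[(\<Sum>j<k. X j * x j) = 0] (mod int p)" "[(\<Sum>j<k. Y j * x j) = 0] (mod int p)"
  shows "int p dvd (\<Sum>j<k. u j * x j)"
proof -
  have "[(\<Sum>j<k. (u j * det2 X Y a b) * x j) =
         (\<Sum>j<k. (- u a * det2 X Y b j - u b * det2 X Y j a) * x j)] (mod int p)"
  proof (intro cong_sum cong_scalar_right)
    fix j assume "j \<in> {..<k}"
    then have "int p dvd u a * det2 X Y b j + u b * det2 X Y j a + u j * det2 X Y a b"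
      using assms(1) D unfolding pluecker_def by (auto simp: cong_0_iff)
    then show "[u j * det2 X Y a b = - u a * det2 X Y b j - u b * det2 X Y j a] (mod int p)"
      unfolding cong_iff_dvd_diff by (simp add: algebra_simps)
  qed
  also have "(\<Sum>j<k. (- u a * det2 X Y b j - u b * det2 X Y j a) * x j) =
     (u b * X a - u a * X b) * (\<Sum>j<k. Y j * x j) + (u a * Y b - u b * Y a) * (\<Sum>j<k. X j * x j)"
  proof -
    have "(- u a * det2 X Y b j - u b * det2 X Y j a) * x j =
        (u b * X a - u a * X b) * (Y j * x j) + (u a * Y b - u b * Y a) * (X j * x j)" for j
      by (simp add: det2_def algebra_simps)
    then show ?thesis by (simp only: sum.distrib sum_distrib_left)
  qed
  also have "[\<dots> = (u b * X a - u a * X b) * 0 + (u a * Y b - u b * Y a) * 0] (mod int p)"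
    by (intro cong_add cong_scalar_left assms)
  finally have "int p dvd det2 X Y a b * (\<Sum>j<k. u j * x j)"
    by (simp add: cong_0_iff sum_distrib_left algebra_simps)
  then show ?thesis
    using assms by (metis prime_dvd_mult_iff prime_nat_int_transfer)
qed

text \<open>Orthogonality on the solution space: if some coordinate of the frequency leaves the row
  space, there is a solution on which the character is nontrivial, and translation by it kills the
  sum.\<close>

lemma sum_add_char_solutions2:
  assumes p: "prime p" and D: "a\<^sub>0 < k" "b\<^sub>0 < k" "\<not> int p dvd det2 X Y a\<^sub>0 b\<^sub>0"
  shows "(\<Sum>x\<in>solutions2 p n k X Y. add_char p (\<Sum>j<k. \<Sum>c<n. \<xi> j c * x j c)) =
    (if \<forall>c<n. pluecker p k X Y (\<lambda>j. \<xi> j c) then of_nat (card (solutions2 p n k X Y)) else 0)"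
proof (cases "\<forall>c<n. pluecker p k X Y (\<lambda>j. \<xi> j c)")
  case True
  have "add_char p (\<Sum>j<k. \<Sum>c<n. \<xi> j c * x j c) = 1" if x: "x \<in> solutions2 p n k X Y" for x
  proof -
    have "int p dvd (\<Sum>j<k. \<xi> j c * x j c)" if "c < n" for c
      using solution_annihilates[of p k X Y "\<lambda>j. \<xi> j c" a\<^sub>0 b\<^sub>0 "\<lambda>j. x j c"] True x p D that
      by (auto simp: solutions2_def)
    then have "int p dvd (\<Sum>c<n. \<Sum>j<k. \<xi> j c * x j c)"
      by (rule dvd_sum) (simp only: lessThan_iff)
    then show ?thesis
      using p by (subst sum.swap) (simp add: add_char_eq_1_iff prime_gt_0_nat)
  qed
  then show ?thesis using True by simp
next
  case False
  have p0: "p > 0" using p by (simp add: prime_gt_0_nat)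
  from False obtain c\<^sub>0 a b l where c0: "c\<^sub>0 < n" and abl: "a < k" "b < k" "l < k"
    and ne: "\<not> int p dvd \<xi> a c\<^sub>0 * det2 X Y b l + \<xi> b c\<^sub>0 * det2 X Y l a + \<xi> l c\<^sub>0 * det2 X Y a b"
    unfolding pluecker_def by (auto simp: cong_0_iff)
  \<comment> \<open>Cofactors of a 3x3 determinant: paired with \<open>X\<close> or \<open>Y\<close>
    they give a determinant with two equal rows, so the equations hold over the integers; paired
    with \<open>\<xi>\<close> they give the minor that is nonzero modulo \<open>p\<close>. Adding
    indicators covers coinciding \<open>a\<close>, \<open>b\<close>, \<open>l\<close>.\<close>
  define z where "z j = (if j = a then det2 X Y b l else 0) + (if j = b then det2 X Y l a else 0)
    + (if j = l then det2 X Y a b else 0)" for j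
  define y where "y j c = (if c = c\<^sub>0 then z j else 0)" for j c
  have z: "(\<Sum>j<k. w j * z j) = w a * det2 X Y b l + w b * det2 X Y l a + w l * det2 X Y a b" for w
  proof -
    have delta: "(\<Sum>j<k. w j * (if j = i then d else 0)) = w i * d" if "i < k" for i d
      using that by (simp add: if_distrib cong: if_cong)
    show ?thesis
      by (simp only: z_def distrib_left sum.distrib delta[OF abl(1)] delta[OF abl(2)] delta[OF abl(3)])
  qed
  have y: "(\<Sum>j<k. w j * y j c) =
      (if c = c\<^sub>0 then w a * det2 X Y b l + w b * det2 X Y l a + w l * det2 X Y a b else 0)" for w c
    using z by (simp add: y_def)
  have X0: "(\<Sum>j<k. X j * y j c) = 0" and Y0: "(\<Sum>j<k. Y j * y j c) = 0" for c
    unfolding y by (auto simp: det2_def algebra_simps)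
  let ?\<chi> = "\<lambda>x. add_char p (\<Sum>j<k. \<Sum>c<n. \<xi> j c * x j c)"
  let ?S = "solutions2 p n k X Y"
  have \<chi>_shift: "?\<chi> (shift_sol p n k y x) = ?\<chi> y * ?\<chi> x" for x
  proof -
    have "(\<Sum>j<k. \<Sum>c<n. \<xi> j c * shift_sol p n k y x j c) =
        (\<Sum>j<k. \<Sum>c<n. \<xi> j c * ((x j c + y j c) mod int p))"
      by (intro sum.cong) (auto simp: shift_sol_def)
    also have "[\<dots> = (\<Sum>j<k. (\<Sum>c<n. \<xi> j c * x j c) + (\<Sum>c<n. \<xi> j c * y j c))] (mod int p)"
      by (intro cong_sum sum_mod_cong)
    finally show ?thesis
      using add_char_cong[OF p0] by (simp add: sum.distrib add_char_add)
  qed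
  have "(\<Sum>j<k. \<Sum>c<n. \<xi> j c * y j c) =
      \<xi> a c\<^sub>0 * det2 X Y b l + \<xi> b c\<^sub>0 * det2 X Y l a + \<xi> l c\<^sub>0 * det2 X Y a b"
    using c0 by (subst sum.swap) (simp add: y)
  then have \<chi>y: "?\<chi> y \<noteq> 1"
    using ne by (simp add: add_char_eq_1_iff[OF p0])
  have "(\<Sum>x\<in>?S. ?\<chi> x) = (\<Sum>x\<in>?S. ?\<chi> (shift_sol p n k y x))"
  proof (rule sum.reindex_bij_witness[where i = "shift_sol p n k y"
        and j = "shift_sol p n k (\<lambda>j c. - y j c)"])
    fix x assume x: "x \<in> ?S"
    show "shift_sol p n k (\<lambda>j c. - y j c) (shift_sol p n k y x) = x"
      by (rule shift_sol_uminus[OF x])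
    show "shift_sol p n k y x \<in> ?S"
      by (rule shift_sol_in_solutions2[OF p0 x X0 Y0])
    show 1: "shift_sol p n k y (shift_sol p n k (\<lambda>j c. - y j c) x) = x"
      using shift_sol_uminus[OF x, of "\<lambda>j c. - y j c"] by simp
    show "shift_sol p n k (\<lambda>j c. - y j c) x \<in> ?S"
      by (rule shift_sol_in_solutions2[OF p0 x]) (simp_all add: X0 Y0 sum_negf)
    show "?\<chi> (shift_sol p n k y (shift_sol p n k (\<lambda>j c. - y j c) x)) = ?\<chi> x"
      by (simp only: 1)
  qed
  also have "\<dots> = ?\<chi> y * (\<Sum>x\<in>?S. ?\<chi> x)"
    by (simp only: \<chi>_shift sum_distrib_left)
  finally have "(\<Sum>x\<in>?S. ?\<chi> x) = 0"
    using \<chi>y by simp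
  then show ?thesis by (simp only: if_not_P[OF False])
qed

section \<open>Products of linear forms\<close>

lemma det2_self [simp]: "det2 X Y i i = 0"
  by (simp add: det2_def)

text \<open>Homogeneous Lagrange interpolation. By linearity the last form may be taken to be
  \<open>det2 X Y a\<close> or \<open>det2 X Y b\<close>. The former kills the term
  \<open>j = a\<close> and cancels the factor \<open>i = a\<close> in all other denominators, which
  leaves the identity for \<open>J - {a}\<close> with one form less.\<close>

lemma lagrange_rat:
  fixes X Y :: "nat \<Rightarrow> int" and \<alpha> \<beta> :: "nat \<Rightarrow> rat"
  assumes "finite J" "card J = d + 2"
    and "\<And>i j. i \<in> J \<Longrightarrow> j \<in> J \<Longrightarrow> i \<noteq> j \<Longrightarrow> det2 X Y i j \<noteq> 0"
  shows "(\<Sum>j\<in>J. (\<Prod>t<d. \<alpha> t * of_int (X j) + \<beta> t * of_int (Y j)) /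
    of_int (\<Prod>i\<in>J - {j}. det2 X Y i j)) = 0"
  using assms
proof (induction d arbitrary: J)
  case 0
  then obtain a b where J: "J = {a, b}" "a \<noteq> b"
    by (metis add_0 card_2_iff)
  then have "J - {a} = {b}" "J - {b} = {a}" by auto
  moreover have "det2 X Y a b = - det2 X Y b a" by (simp add: det2_def)
  ultimately show ?case using J by simp
next
  case (Suc d)
  have fin: "finite J" by fact
  obtain a b where ab: "a \<in> J" "b \<in> J" "a \<noteq> b"
  proof -
    have "\<not> card J \<le> Suc 0" using Suc.prems by simp
    then show ?thesis using that card_le_Suc0_iff_eq[OF fin] by blast
  qed
  define F where "F j = (\<Prod>t<d. \<alpha> t * of_int (X j) + \<beta> t * of_int (Y j))" for j
  define Q where "Q j = (of_int (\<Prod>i\<in>J - {j}. det2 X Y i j) :: rat)" for j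
  have drop: "(\<Sum>j\<in>J. F j * of_int (det2 X Y a j) / Q j) = 0" if a: "a \<in> J" for a
  proof -
    have "(\<Sum>j\<in>J. F j * of_int (det2 X Y a j) / Q j) =
        (\<Sum>j\<in>J - {a}. F j * of_int (det2 X Y a j) / Q j)"
      using fin a by (simp add: sum.remove)
    also have "\<dots> = (\<Sum>j\<in>J - {a}. F j / of_int (\<Prod>i\<in>J - {a} - {j}. det2 X Y i j))"
    proof (intro sum.cong refl)
      fix j assume j: "j \<in> J - {a}"
      have "(\<Prod>i\<in>J - {j}. det2 X Y i j) =
          det2 X Y a j * (\<Prod>i\<in>J - {j} - {a}. det2 X Y i j)"
        using fin a j by (intro prod.remove) auto
      moreover have "J - {j} - {a} = J - {a} - {j}" by blast
      moreover have "det2 X Y a j \<noteq> 0" using Suc.prems(3) a j by blast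
      ultimately show "F j * of_int (det2 X Y a j) / Q j =
          F j / of_int (\<Prod>i\<in>J - {a} - {j}. det2 X Y i j)"
        by (simp add: Q_def)
    qed
    also have "\<dots> = 0"
      unfolding F_def using Suc.prems a by (intro Suc.IH) auto
    finally show ?thesis .
  qed
  define \<Delta> where "\<Delta> = (of_int (det2 X Y a b) :: rat)"
  have \<Delta>: "\<Delta> \<noteq> 0" using Suc.prems(3) ab by (simp add: \<Delta>_def)
  \<comment> \<open>Evaluation at \<open>b\<close> and at \<open>a\<close>, where one of the two
    determinants vanishes, dictates the coefficients \<open>\<mu>\<close> and
    \<open>\<nu>\<close>.\<close>
  define \<mu> where "\<mu> = (\<beta> d * of_int (Y b) + \<alpha> d * of_int (X b)) / \<Delta>"
  define \<nu> where "\<nu> = - (\<beta> d * of_int (Y a) + \<alpha> d * of_int (X a)) / \<Delta>"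
  have split: "\<alpha> d * of_int (X j) + \<beta> d * of_int (Y j) =
      \<mu> * of_int (det2 X Y a j) + \<nu> * of_int (det2 X Y b j)" for j
  proof -
    have "\<Delta> * (\<mu> * of_int (det2 X Y a j) + \<nu> * of_int (det2 X Y b j)) =
       (\<beta> d * of_int (Y b) + \<alpha> d * of_int (X b)) * of_int (det2 X Y a j) -
       (\<beta> d * of_int (Y a) + \<alpha> d * of_int (X a)) * of_int (det2 X Y b j)"
    proof -
      have "\<Delta> * \<mu> = \<beta> d * of_int (Y b) + \<alpha> d * of_int (X b)"
        "\<Delta> * \<nu> = - (\<beta> d * of_int (Y a) + \<alpha> d * of_int (X a))"
        using \<Delta> by (simp_all add: \<mu>_def \<nu>_def)
      then show ?thesis by (simp only: distrib_left mult.assoc[symmetric])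
    qed
    also have "\<dots> = \<Delta> * (\<alpha> d * of_int (X j) + \<beta> d * of_int (Y j))"
      by (simp add: \<Delta>_def det2_def algebra_simps)
    finally show ?thesis using \<Delta> by simp
  qed
  have "(\<Sum>j\<in>J. (\<Prod>t<Suc d. \<alpha> t * of_int (X j) + \<beta> t * of_int (Y j)) / Q j) =
      (\<Sum>j\<in>J. \<mu> * (F j * of_int (det2 X Y a j) / Q j) + \<nu> * (F j * of_int (det2 X Y b j) / Q j))"
    by (intro sum.cong refl)
      (simp only: prod.lessThan_Suc F_def[symmetric] split distrib_left add_divide_distrib
        times_divide_eq_right mult.left_commute)
  also have "\<dots> = 0"
    unfolding sum.distrib sum_distrib_left[symmetric] using drop ab by simp
  finally show ?case unfolding Q_def .
qed

text \<open>The weights of \<open>lagrange_rat\<close> multiplied by the product of all their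
  denominators: omitting the factor \<open>a = j\<close> is the division by the denominator of
  \<open>j\<close>, and the result is an integer.\<close>

definition lagrange_weight :: "(nat \<Rightarrow> int) \<Rightarrow> (nat \<Rightarrow> int) \<Rightarrow> nat \<Rightarrow> nat \<Rightarrow> int" where
  "lagrange_weight X Y k j = (\<Prod>a\<in>{..<k} - {j}. \<Prod>i\<in>{..<k} - {a}. det2 X Y i a)"

lemma lagrange_int:
  fixes X Y :: "nat \<Rightarrow> int" and \<alpha> \<beta> :: "nat \<Rightarrow> int"
  assumes "k \<ge> 2" and D: "\<And>i j. i < k \<Longrightarrow> j < k \<Longrightarrow> i \<noteq> j \<Longrightarrow> det2 X Y i j \<noteq> 0"
  shows "(\<Sum>j<k. lagrange_weight X Y k j * (\<Prod>t<k - 2. \<alpha> t * X j + \<beta> t * Y j)) = 0"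
proof -
  define P where "P = (\<Prod>a<k. \<Prod>i\<in>{..<k} - {a}. det2 X Y i a)"
  have w: "rat_of_int (lagrange_weight X Y k j) = of_int P / of_int (\<Prod>i\<in>{..<k} - {j}. det2 X Y i j)"
    if "j < k" for j
  proof -
    have "P = (\<Prod>i\<in>{..<k} - {j}. det2 X Y i j) * lagrange_weight X Y k j"
      unfolding P_def lagrange_weight_def using that by (intro prod.remove) auto
    moreover have "(\<Prod>i\<in>{..<k} - {j}. det2 X Y i j) \<noteq> 0"
      using D that by auto
    ultimately show ?thesis by simp
  qed
  have "rat_of_int (\<Sum>j<k. lagrange_weight X Y k j * (\<Prod>t<k - 2. \<alpha> t * X j + \<beta> t * Y j)) =
     (\<Sum>j<k. of_int P * ((\<Prod>t<k - 2. of_int (\<alpha> t) * of_int (X j) + of_int (\<beta> t) * of_int (Y j)) /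
      of_int (\<Prod>i\<in>{..<k} - {j}. det2 X Y i j)))"
    unfolding of_int_sum of_int_mult by (intro sum.cong refl) (subst w, auto)
  also have "\<dots> = 0"
    unfolding sum_distrib_left[symmetric]
    using lagrange_rat[of "{..<k}" "k - 2" X Y "\<lambda>t. of_int (\<alpha> t)" "\<lambda>t. of_int (\<beta> t)"] assms
    by auto
  finally show ?thesis by linarith
qed

section \<open>Zeros of multilinear forms modulo a prime\<close>

lemma eq_if_dvd_diff:
  fixes x y :: int
  assumes "int p dvd x - y" "x \<in> {0..<int p}" "y \<in> {0..<int p}"
  shows "x = y"
proof -
  have "x mod int p = y mod int p" using assms(1) by (simp add: mod_eq_dvd_iff)
  then show ?thesis using assms by simp
qed

text \<open>A coordinate with invertible coefficient is determined by the other one, so one of the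
  projections is injective on the zeros.\<close>

lemma card_linear_zeros:
  assumes p: "prime p" and ab: "\<not> (int p dvd a \<and> int p dvd b)"
  shows "card {q \<in> {0..<int p} \<times> {0..<int p}. int p dvd a * fst q + b * snd q} \<le> p"
    (is "card ?Z \<le> p")
proof -
  have prime: "prime (int p)" using p by simp
  have sub: "snd ` ?Z \<subseteq> {0..<int p}" "fst ` ?Z \<subseteq> {0..<int p}" by auto
  have diff: "int p dvd a * (fst q - fst q') + b * (snd q - snd q')" if "q \<in> ?Z" "q' \<in> ?Z" for q q'
  proof -
    have "int p dvd (a * fst q + b * snd q) - (a * fst q' + b * snd q')"
      using that by (intro dvd_diff) auto
    then show ?thesis by (simp add: algebra_simps)
  qed
  consider "\<not> int p dvd a" | "\<not> int p dvd b" using ab by blast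
  then show ?thesis
  proof cases
    case 1
    have "inj_on snd ?Z"
    proof (rule inj_onI)
      fix q q' assume q: "q \<in> ?Z" "q' \<in> ?Z" "snd q = snd q'"
      then have "int p dvd fst q - fst q'"
        using diff[OF q(1,2)] 1 prime by (simp add: prime_dvd_mult_iff)
      then have "fst q = fst q'" using q(1,2) by (intro eq_if_dvd_diff[of p]) auto
      then show "q = q'" using q(3) by (simp add: prod_eq_iff)
    qed
    then show ?thesis using card_inj_on_le[OF _ sub(1)] by simp
  next
    case 2
    have "inj_on fst ?Z"
    proof (rule inj_onI)
      fix q q' assume q: "q \<in> ?Z" "q' \<in> ?Z" "fst q = fst q'"
      then have "int p dvd snd q - snd q'"
        using diff[OF q(1,2)] 2 prime by (simp add: prime_dvd_mult_iff)
      then have "snd q = snd q'" using q(1,2) by (intro eq_if_dvd_diff[of p]) auto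
      then show "q = q'" using q(3) by (simp add: prod_eq_iff)
    qed
    then show ?thesis using card_inj_on_le[OF _ sub(2)] by simp
  qed
qed

text \<open>A multilinear form in \<open>d\<close> points of the plane. The weights \<open>e\<close>
  are arbitrary so that they can absorb the linear forms of an argument that has been fixed, as in
  \<open>form_product_Suc\<close>.\<close>

definition form_product :: "'j set \<Rightarrow> ('j \<Rightarrow> int) \<Rightarrow> ('j \<Rightarrow> int) \<Rightarrow> ('j \<Rightarrow> int) \<Rightarrow> nat \<Rightarrow>
    (nat \<Rightarrow> int \<times> int) \<Rightarrow> int" where
  "form_product J A B e d \<mu> = (\<Sum>j\<in>J. e j * (\<Prod>t<d. A j * fst (\<mu> t) + B j * snd (\<mu> t)))"

lemma form_product_Suc:
  "form_product J A B e (Suc d) \<mu> =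
    form_product J A B (\<lambda>j. e j * (A j * fst (\<mu> d) + B j * snd (\<mu> d))) d \<mu>"
  unfolding form_product_def by (intro sum.cong refl) (simp add: algebra_simps)

lemma form_product_cong:
  "(\<And>t. t < d \<Longrightarrow> \<mu> t = \<mu>' t) \<Longrightarrow> form_product J A B e d \<mu> = form_product J A B e d \<mu>'"
  unfolding form_product_def by (intro sum.cong refl arg_cong2[of _ _ _ _ "(*)"] prod.cong) auto

text \<open>
  Fixing the arguments of a nonzero multilinear form one at a time to random values, each step
  destroys the nonvanishing with probability at most \<open>1 / p\<close>.
\<close>

lemma card_form_product_zeros:
  fixes A B e :: "'j \<Rightarrow> int"
  assumes p: "prime p" and "\<not> int p dvd form_product J A B e d \<mu>"
  shows "p * card {h \<in> {..<d} \<rightarrow>\<^sub>E {0..<int p} \<times> {0..<int p}.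
      int p dvd form_product J A B e d h} \<le> d * p ^ (2 * d)"
  using assms(2)
proof (induction d arbitrary: e)
  case 0
  then show ?case by (simp add: form_product_def)
next
  case (Suc d)
  define P where "P = {0..<int p} \<times> {0..<int p}"
  have finP: "finite P" and cardP: "card P = p ^ 2"
    by (simp_all add: P_def power2_eq_square)
  define e' where "e' q j = e j * (A j * fst q + B j * snd q)" for q j
  define Z where "Z q = {h \<in> {..<d} \<rightarrow>\<^sub>E P. int p dvd form_product J A B (e' q) d h}" for q
  \<comment> \<open>With the other arguments held at \<open>\<mu>\<close>, the value is a linear
    form in the last argument, with coefficients \<open>a\<close> and \<open>b\<close>.\<close>
  define a where "a = form_product J A B (\<lambda>j. e j * A j) d \<mu>"
  define b where "b = form_product J A B (\<lambda>j. e j * B j) d \<mu>"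
  have lin: "form_product J A B (e' q) d \<mu> = a * fst q + b * snd q" for q
    unfolding a_def b_def form_product_def e'_def sum_distrib_right sum.distrib[symmetric]
    by (intro sum.cong refl) (simp add: algebra_simps)
  have "\<not> int p dvd a * fst (\<mu> d) + b * snd (\<mu> d)"
    using Suc.prems unfolding form_product_Suc lin[symmetric] e'_def .
  then have ab: "\<not> (int p dvd a \<and> int p dvd b)" by auto
  \<comment> \<open>For \<open>q\<close> in \<open>Bad\<close> the point \<open>\<mu>\<close> no
    longer witnesses that the remaining form is nonzero, so all of its arguments are counted; for
    other \<open>q\<close> the induction hypothesis applies.\<close>
  define Bad where "Bad = {q \<in> P. int p dvd a * fst q + b * snd q}"
  have Bad: "card Bad \<le> p" "Bad \<subseteq> P"
    unfolding Bad_def P_def by (rule card_linear_zeros[OF p ab]) auto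
  have finE: "finite ({..<d} \<rightarrow>\<^sub>E P)" and cardE: "card ({..<d} \<rightarrow>\<^sub>E P) = p ^ (2 * d)"
    using finP cardP by (auto intro: finite_PiE simp: card_PiE power_mult)
  have finZ: "finite (Z q)" for q unfolding Z_def using finE by simp
  let ?Z = "{h \<in> {..<Suc d} \<rightarrow>\<^sub>E P. int p dvd form_product J A B e (Suc d) h}"
  have "card ?Z \<le> card (SIGMA q:P. Z q)"
  proof (rule card_inj_on_le[where f = "\<lambda>h. (h d, restrict h {..<d})"])
    show "inj_on (\<lambda>h. (h d, restrict h {..<d})) ?Z"
    proof (rule inj_onI)
      fix f g assume fg: "f \<in> ?Z" "g \<in> ?Z" "(f d, restrict f {..<d}) = (g d, restrict g {..<d})"
      then have eq: "f d = g d" "restrict f {..<d} = restrict g {..<d}" by blast+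
      have "f t = g t" if "t < d" for t
        using fun_cong[OF eq(2), of t] that by simp
      then have "f t = g t" if "t < Suc d" for t
        using that eq(1) less_Suc_eq by blast
      moreover have "f \<in> {..<Suc d} \<rightarrow>\<^sub>E P" "g \<in> {..<Suc d} \<rightarrow>\<^sub>E P"
        using fg(1,2) by blast+
      ultimately show "f = g"
        by (metis PiE_ext lessThan_iff)
    qed
    show "(\<lambda>h. (h d, restrict h {..<d})) ` ?Z \<subseteq> (SIGMA q:P. Z q)"
    proof (rule image_subsetI)
      fix f assume f: "f \<in> ?Z"
      have "form_product J A B (e' (f d)) d (restrict f {..<d}) = form_product J A B e (Suc d) f"
        unfolding form_product_Suc e'_def by (rule form_product_cong) simp
      moreover have "f t \<in> P" if "t < Suc d" for t
        using f that PiE_mem[of f "{..<Suc d}" "\<lambda>_. P" t] by simp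
      ultimately show "(f d, restrict f {..<d}) \<in> (SIGMA q:P. Z q)"
        using f by (simp add: Z_def restrict_PiE_iff)
    qed
    show "finite (SIGMA q:P. Z q)" using finP finZ by simp
  qed
  also have "\<dots> = (\<Sum>q\<in>P. card (Z q))"
    using finP finZ by simp
  finally have "p * card ?Z \<le> (\<Sum>q\<in>P. p * card (Z q))"
    by (simp add: sum_distrib_left[symmetric])
  also have "\<dots> = (\<Sum>q\<in>Bad. p * card (Z q)) + (\<Sum>q\<in>P - Bad. p * card (Z q))"
    using sum.subset_diff[OF Bad(2) finP] by (simp add: add.commute)
  also have "\<dots> \<le> (\<Sum>q\<in>Bad. p * p ^ (2 * d)) + (\<Sum>q\<in>P - Bad. d * p ^ (2 * d))"
  proof (intro add_mono sum_mono mult_left_mono)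
    show "card (Z q) \<le> p ^ (2 * d)" for q
      unfolding cardE[symmetric] Z_def using finE by (intro card_mono) auto
    fix q assume "q \<in> P - Bad"
    then have "\<not> int p dvd form_product J A B (e' q) d \<mu>" by (simp add: lin Bad_def)
    then show "p * card (Z q) \<le> d * p ^ (2 * d)"
      unfolding Z_def P_def by (rule Suc.IH)
  qed simp_all
  also have "\<dots> \<le> p * (p * p ^ (2 * d)) + p ^ 2 * (d * p ^ (2 * d))"
  proof -
    have "card (P - Bad) \<le> p ^ 2"
      unfolding cardP[symmetric] using finP by (intro card_mono) auto
    then show ?thesis using Bad(1) by (simp add: add_mono)
  qed
  also have "\<dots> = Suc d * p ^ (2 * Suc d)"
    by (simp add: power2_eq_square algebra_simps)
  finally show ?case unfolding P_def .
qed

text \<open>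
  The relation on \<open>\<epsilon>\<close> says that the vectors \<open>\<epsilon> j * (X j, Y j)\<close> lie on an affine line; \<open>y\<close> is a
  coordinate on it.  Testing with the linear forms that vanish at all points but the two leftmost
  ones leaves two terms, of different absolute values.
\<close>

lemma form_product_nonzero:
  assumes k: "k \<ge> 3" and D: "\<And>i j. i < k \<Longrightarrow> j < k \<Longrightarrow> i \<noteq> j \<Longrightarrow> det2 X Y i j \<noteq> 0"
    and M: "\<And>i j. i < k \<Longrightarrow> j < k \<Longrightarrow> \<bar>det2 X Y i j\<bar> \<le> M"
    and p: "int p > 2 * M ^ (k - 2)"
    and \<epsilon>: "\<And>j. j < k \<Longrightarrow> \<epsilon> j \<in> {1, - 1 :: int}"
    and rel: "\<And>a b l. a < k \<Longrightarrow> b < k \<Longrightarrow> l < k \<Longrightarrow>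
      \<epsilon> a * det2 X Y b l + \<epsilon> b * det2 X Y l a + \<epsilon> l * det2 X Y a b = 0"
  obtains \<sigma> where "\<And>t. t < k - 2 \<Longrightarrow> \<sigma> t < k"
    "\<not> int p dvd (\<Sum>j<k. \<epsilon> j * (\<Prod>t<k - 2. det2 X Y (\<sigma> t) j))"
proof -
  define y where "y j = \<epsilon> j * det2 X Y j 0" for j
  \<comment> \<open>The relation on \<open>i\<close>, \<open>j\<close>, \<open>0\<close> turns
    minors into distances between coordinates on the line.\<close>
  have abs_D: "\<bar>det2 X Y i j\<bar> = \<bar>y i - y j\<bar>" if ij: "i < k" "j < k" for i j
  proof -
    have 0: "0 < k" using k by simp
    have "\<epsilon> 0 * det2 X Y i j = \<epsilon> j * det2 X Y i 0 - \<epsilon> i * det2 X Y j 0"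
      using rel[OF ij 0] by (simp add: det2_def algebra_simps)
    moreover have "\<epsilon> j * det2 X Y i 0 - \<epsilon> i * det2 X Y j 0 = \<epsilon> i * \<epsilon> j * (y i - y j)"
      using \<epsilon>[OF ij(1)] \<epsilon>[OF ij(2)] by (auto simp: y_def)
    ultimately have "\<bar>\<epsilon> 0 * det2 X Y i j\<bar> = \<bar>\<epsilon> i * \<epsilon> j * (y i - y j)\<bar>" by simp
    then show ?thesis
      using \<epsilon>[OF ij(1)] \<epsilon>[OF ij(2)] \<epsilon>[OF 0] by (auto simp: abs_mult)
  qed
  have y_inj: "y i \<noteq> y j" if "i < k" "j < k" "i \<noteq> j" for i j
    using abs_D[of i j] D[of i j] that by auto
  have argmin: "\<exists>i\<in>S. \<forall>j\<in>S. y i \<le> y j" if "S \<noteq> {}" "finite S" for S :: "nat set"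
    using arg_min_if_finite[of S y] that by (meson not_le)
  have "0 \<in> {..<k}" using k by simp
  then have "{..<k} \<noteq> {}" by blast
  from argmin[OF this] obtain j1 where j1: "j1 < k" "\<And>j. j < k \<Longrightarrow> y j1 \<le> y j"
    by blast
  have ne: "{..<k} - {j1} \<noteq> {}"
  proof -
    have "card ({..<k} - {j1}) = k - 1" using j1 by simp
    then show ?thesis using k by (intro notI) (simp only: card.empty)
  qed
  then obtain j2 where j2: "j2 \<in> {..<k} - {j1}" "\<And>j. j \<in> {..<k} - {j1} \<Longrightarrow> y j2 \<le> y j"
    using argmin[OF ne] by blast
  define R where "R = {..<k} - {j1, j2}"
  have R: "finite R" "card R = k - 2"
    using j1 j2 by (simp_all add: R_def card_Diff_subset)
  then have R_ne: "R \<noteq> {}" using k by auto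
  obtain \<sigma> where "bij_betw \<sigma> {0..<card R} R"
    using ex_bij_betw_nat_finite[OF R(1)] by blast
  then have \<sigma>: "bij_betw \<sigma> {..<k - 2} R" by (simp add: R(2) atLeast0LessThan)
  define Q where "Q j = (\<Prod>i\<in>R. det2 X Y i j)" for j
  have Q: "(\<Prod>t<k - 2. det2 X Y (\<sigma> t) j) = Q j" for j
    unfolding Q_def by (rule prod.reindex_bij_betw[OF \<sigma>])
  have "(\<Sum>j<k. \<epsilon> j * Q j) = (\<Sum>j\<in>{j1, j2}. \<epsilon> j * Q j)"
  proof (rule sum.mono_neutral_right)
    show "\<forall>j\<in>{..<k} - {j1, j2}. \<epsilon> j * Q j = 0"
      using R(1) unfolding Q_def by (auto simp: R_def intro!: prod_zero bexI)
  qed (use j1 j2 in auto)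
  then have sum: "(\<Sum>j<k. \<epsilon> j * Q j) = \<epsilon> j1 * Q j1 + \<epsilon> j2 * Q j2"
    using j2(1) by auto
  have abs_Q: "\<bar>Q j\<bar> = (\<Prod>i\<in>R. y i - y j)" if "j \<in> {j1, j2}" for j
    unfolding Q_def abs_prod
  proof (intro prod.cong refl)
    fix i assume "i \<in> R"
    then have "i < k" "y j \<le> y i" "j < k" using that j1 j2 by (auto simp: R_def)
    then show "\<bar>det2 X Y i j\<bar> = y i - y j" by (simp add: abs_D)
  qed
  \<comment> \<open>All points of \<open>R\<close> lie to the right of \<open>j2\<close>, hence
    strictly farther from \<open>j1\<close> than from \<open>j2\<close>.\<close>
  have "\<bar>Q j2\<bar> < \<bar>Q j1\<bar>"
  proof -
    have lt: "y j1 < y j2" using j1 j2(1) y_inj[of j1 j2] by (metis DiffE insertCI lessThan_iff less_le)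
    have "y j2 < y i" if "i \<in> R" for i
      using j2 y_inj[of j2 i] that by (auto simp: R_def less_le)
    then have "(\<Prod>i\<in>R. y i - y j2) < (\<Prod>i\<in>R. y i - y j1)"
      using R(1) R_ne lt by (intro prod_mono_strict[of "SOME i. i \<in> R"]) (auto simp: some_in_eq less_imp_le intro: less_trans)
    then show ?thesis by (simp add: abs_Q)
  qed
  moreover have abs_Q_le: "\<bar>Q j\<bar> \<le> M ^ (k - 2)" if "j < k" for j
  proof -
    have "\<bar>Q j\<bar> \<le> (\<Prod>i\<in>R. M)"
      unfolding Q_def abs_prod using that M by (intro prod_mono) (auto simp: R_def)
    then show ?thesis by (simp add: R(2))
  qed
  moreover have "\<bar>\<epsilon> j1 * Q j1\<bar> = \<bar>Q j1\<bar>" "\<bar>\<epsilon> j2 * Q j2\<bar> = \<bar>Q j2\<bar>"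
    using \<epsilon>[of j1] \<epsilon>[of j2] j1(1) j2(1) by (auto simp: abs_mult)
  \<comment> \<open>Two terms of different absolute value cannot cancel, and \<open>p\<close>
    exceeds twice the bound on each of them.\<close>
  ultimately have "(\<Sum>j<k. \<epsilon> j * Q j) \<noteq> 0" "\<bar>\<Sum>j<k. \<epsilon> j * Q j\<bar> < int p"
    using p abs_Q_le[OF j1(1)] abs_triangle_ineq[of "\<epsilon> j1 * Q j1" "\<epsilon> j2 * Q j2"]
    unfolding sum by linarith+
  then have "\<not> int p dvd (\<Sum>j<k. \<epsilon> j * Q j)"
    using zdvd_not_zless by (metis abs_dvd_iff dvd_imp_le_int leD of_nat_0_le_iff abs_of_nonneg)
  moreover have "\<sigma> t < k" if "t < k - 2" for t
    using bij_betwE[OF \<sigma>] that by (auto simp: R_def)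
  ultimately show ?thesis using that[of \<sigma>] by (simp add: Q)
qed

section \<open>The test function\<close>

text \<open>The first bound on \<open>p\<close> keeps single minors and signed sums of three minors
  below \<open>p\<close>; the second serves \<open>form_product_nonzero\<close>. The third beats the
  number of tuples with constant index: \<open>k\<close> indices, \<open>2 ^ k\<close> sign
  patterns, and for each at most the fraction \<open>(k - 2) / p\<close> of
  \<open>p ^ (2 * (k - 2))\<close>.\<close>

locale generic_system =
  fixes X Y :: "nat \<Rightarrow> int" and k p :: nat and M :: int
  assumes k_ge: "k \<ge> 4" and k_even: "even k" and p_prime: "prime p"
    and det2_nonzero: "i < k \<Longrightarrow> j < k \<Longrightarrow> i \<noteq> j \<Longrightarrow> det2 X Y i j \<noteq> 0"
    and det2_le: "i < k \<Longrightarrow> j < k \<Longrightarrow> \<bar>det2 X Y i j\<bar> \<le> M"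
    and p_gt: "int p > 3 * M" "int p > 2 * M ^ (k - 2)" "p > k * 2 ^ k * (k - 2)"
begin

lemma p_pos: "p > 0" and prime_int_p: "prime (int p)"
  using p_prime by (simp_all add: prime_gt_0_nat)

lemma p_dvd_mult_iff: "int p dvd a * b \<longleftrightarrow> int p dvd a \<or> int p dvd b"
  by (rule prime_dvd_mult_iff[OF prime_int_p])

lemma eq_0_if_p_dvd: "int p dvd t \<Longrightarrow> \<bar>t\<bar> < int p \<Longrightarrow> t = 0"
  by (metis abs_dvd_iff abs_ge_zero abs_0_eq dvd_abs_iff order.order_iff_strict zdvd_not_zless)

lemma p_dvd_det2_iff:
  assumes "i < k" "j < k"
  shows "int p dvd det2 X Y i j \<longleftrightarrow> i = j"
proof
  assume dvd: "int p dvd det2 X Y i j"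
  have "\<bar>det2 X Y i j\<bar> < int p" using det2_le[OF assms] p_gt(1) by linarith
  then have "det2 X Y i j = 0" using dvd eq_0_if_p_dvd by blast
  then show "i = j" using det2_nonzero assms by blast
qed simp

text \<open>A column has an invertible minor with any other column, so it does not vanish modulo
  \<open>p\<close>.\<close>

lemma col_nonzero_mod_p:
  assumes "i < k" "int p dvd t * X i" "int p dvd t * Y i"
  shows "int p dvd t"
proof -
  obtain j where j: "j < k" "j \<noteq> i"
    using k_ge that[of 0] that[of 1] by force
  have "int p dvd (t * X i) * Y j - X j * (t * Y i)"
    by (rule dvd_diff[OF dvd_mult2[OF assms(2)] dvd_mult[OF assms(3)]])
  then have "int p dvd t * det2 X Y i j"
    by (simp add: det2_def algebra_simps)
  then show ?thesis using p_dvd_det2_iff[OF assms(1) j(1)] j(2) by (simp add: p_dvd_mult_iff)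
qed

abbreviation "d \<equiv> k - 2"

text \<open>
  An index \<open>(i, s, \<epsilon>)\<close> stands for the frequency \<open>\<epsilon> * (X i, Y i, s)\<close> in \<open>\<bbbF>\<^sub>p\<^sup>k\<close>, where \<open>s\<close> takes up
  the last \<open>k - 2\<close> coordinates; its Fourier coefficient has sign \<open>sgn_at i\<close> and argument
  proportional to \<open>phase (i, s, \<epsilon>)\<close>.
\<close>

definition E :: "(nat \<Rightarrow> int) set" where "E = {..<d} \<rightarrow>\<^sub>E {0..<int p}"

definition \<Omega> :: "(nat \<times> (nat \<Rightarrow> int) \<times> int) set" where "\<Omega> = {..<k} \<times> E \<times> {1, - 1}"

definition freq :: "nat \<times> (nat \<Rightarrow> int) \<times> int \<Rightarrow> nat \<Rightarrow> int" where
  "freq \<omega> l = snd (snd \<omega>) *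
    (if l = 0 then X (fst \<omega>) else if l = 1 then Y (fst \<omega>) else fst (snd \<omega>) (l - 2))"

definition phase :: "nat \<times> (nat \<Rightarrow> int) \<times> int \<Rightarrow> int" where
  "phase \<omega> = snd (snd \<omega>) * lagrange_weight X Y k (fst \<omega>) * (\<Prod>t<d. fst (snd \<omega>) t)"

definition sgn_at :: "nat \<Rightarrow> real" where "sgn_at i = (if i = 0 then - 1 else 1)"

text \<open>Opposite frequencies carry conjugate coefficients, so each pair adds up to a real
  cosine. The parameter \<open>c\<close> scales all phases and is averaged over later.\<close>

definition g :: "int \<Rightarrow> (nat \<Rightarrow> int) \<Rightarrow> real" where
  "g c x = (\<Sum>(i, s)\<in>{..<k} \<times> E. sgn_at i *
    (2 * cos (2 * pi * (c * phase (i, s, 1) + (\<Sum>l<k. freq (i, s, 1) l * x l)) / p)))"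

lemma finite_E: "finite E" and card_E: "card E = p ^ d"
  by (simp_all add: E_def finite_PiE card_PiE)

lemma finite_\<Omega>: "finite \<Omega>"
  by (simp add: \<Omega>_def finite_E)

lemma finite_PiE_\<Omega>: "finite S \<Longrightarrow> finite (S \<rightarrow>\<^sub>E \<Omega>)"
  by (simp add: finite_PiE finite_\<Omega>)

lemma \<Omega>D:
  assumes "\<omega> \<in> \<Omega>"
  shows "fst \<omega> < k" "fst (snd \<omega>) \<in> E" "snd (snd \<omega>) \<in> {1, - 1}"
  using assms by (auto simp: \<Omega>_def)

lemma g_abs_le: "\<bar>g c x\<bar> \<le> 2 * k * p ^ d"
proof -
  have "\<bar>g c x\<bar> \<le> (\<Sum>(i, s)\<in>{..<k} \<times> E. 2)"
    unfolding g_def case_prod_beta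
    by (rule order_trans[OF sum_abs sum_mono]) (simp add: abs_mult sgn_at_def)
  also have "\<dots> = 2 * k * p ^ d"
    by (simp add: card_cartesian_product card_E case_prod_beta)
  finally show ?thesis .
qed

lemma of_real_g:
  "complex_of_real (g c x) =
    (\<Sum>\<omega>\<in>\<Omega>. of_real (sgn_at (fst \<omega>)) * add_char p (c * phase \<omega> + (\<Sum>l<k. freq \<omega> l * x l)))"
proof -
  define \<theta> where "\<theta> \<omega> = c * phase \<omega> + (\<Sum>l<k. freq \<omega> l * x l)" for \<omega>
  have neg: "\<theta> (i, s, - 1) = - \<theta> (i, s, 1)" for i s
  proof -
    have "phase (i, s, - 1) = - phase (i, s, 1)" "\<And>l. freq (i, s, - 1) l = - freq (i, s, 1) l"
      by (simp_all add: phase_def freq_def)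
    then show ?thesis by (simp add: \<theta>_def sum_negf)
  qed
  have "(\<Sum>\<omega>\<in>\<Omega>. of_real (sgn_at (fst \<omega>)) * add_char p (\<theta> \<omega>)) =
     (\<Sum>i<k. \<Sum>s\<in>E. \<Sum>\<epsilon>\<in>{1, - 1}. of_real (sgn_at i) * add_char p (\<theta> (i, s, \<epsilon>)))"
    unfolding \<Omega>_def sum.cartesian_product by (intro sum.cong) auto
  also have "\<dots> = (\<Sum>i<k. \<Sum>s\<in>E. of_real (sgn_at i) *
      (add_char p (\<theta> (i, s, 1)) + add_char p (- \<theta> (i, s, 1))))"
    by (simp add: neg algebra_simps)
  also have "\<dots> = (\<Sum>i<k. \<Sum>s\<in>E. of_real (sgn_at i * (2 * cos (2 * pi * \<theta> (i, s, 1) / p))))"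
    unfolding add_char_uminus_add of_real_mult ..
  also have "\<dots> = complex_of_real (g c x)"
    unfolding g_def sum.cartesian_product of_real_sum by (intro sum.cong) (auto simp: \<theta>_def)
  finally show ?thesis unfolding \<theta>_def ..
qed

section \<open>Averages of products of the test function\<close>

text \<open>The frequencies, extended by 0 outside \<open>S\<close>, lie in the row space modulo
  \<open>p\<close> in every coordinate; these are the tuples whose character is trivial on the
  solutions.\<close>

definition resonant :: "nat set \<Rightarrow> (nat \<Rightarrow> nat \<times> (nat \<Rightarrow> int) \<times> int) \<Rightarrow> bool" where
  "resonant S \<tau> \<longleftrightarrow> (\<forall>l<k. pluecker p k X Y (\<lambda>j. if j \<in> S then freq (\<tau> j) l else 0))"

abbreviation "sols \<equiv> solutions2 p k k X Y"

text \<open>Multiplying out the Fourier sums gives one character of the solution space per tuple,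
  and orthogonality keeps the resonant tuples.\<close>

lemma sum_prod_g:
  assumes S: "S \<subseteq> {..<k}"
  shows "(\<Sum>x\<in>sols. \<Prod>j\<in>S. complex_of_real (g c (x j))) =
    of_nat (card sols) * (\<Sum>\<tau> | \<tau> \<in> S \<rightarrow>\<^sub>E \<Omega> \<and> resonant S \<tau>.
      (\<Prod>j\<in>S. of_real (sgn_at (fst (\<tau> j)))) * add_char p (c * (\<Sum>j\<in>S. phase (\<tau> j))))"
proof -
  have finS: "finite S" using S finite_subset by blast
  have 01: "0 < k" "1 < k" using k_ge by simp_all
  have D01: "\<not> int p dvd det2 X Y 0 1" using p_dvd_det2_iff[OF 01] by simp
  define w where "w \<tau> = (\<Prod>j\<in>S. complex_of_real (sgn_at (fst (\<tau> j)))) *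
    add_char p (c * (\<Sum>j\<in>S. phase (\<tau> j)))" for \<tau>
  define \<xi> where "\<xi> \<tau> j l = (if j \<in> S then freq (\<tau> j) l else 0)"
    for \<tau> :: "nat \<Rightarrow> nat \<times> (nat \<Rightarrow> int) \<times> int" and j l
  have expand: "(\<Prod>j\<in>S. complex_of_real (g c (x j))) =
      (\<Sum>\<tau>\<in>S \<rightarrow>\<^sub>E \<Omega>. w \<tau> * add_char p (\<Sum>j<k. \<Sum>l<k. \<xi> \<tau> j l * x j l))" for x
  proof -
    have "(\<Prod>j\<in>S. complex_of_real (g c (x j))) =
      (\<Sum>\<tau>\<in>S \<rightarrow>\<^sub>E \<Omega>. \<Prod>j\<in>S. of_real (sgn_at (fst (\<tau> j))) *
        add_char p (c * phase (\<tau> j) + (\<Sum>l<k. freq (\<tau> j) l * x j l)))"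
      unfolding of_real_g by (rule prod_sum_PiE[OF finS finite_\<Omega>])
    also have "\<dots> = (\<Sum>\<tau>\<in>S \<rightarrow>\<^sub>E \<Omega>. w \<tau> * add_char p (\<Sum>j\<in>S. \<Sum>l<k. freq (\<tau> j) l * x j l))"
      unfolding w_def by (simp add: prod.distrib add_char_add add_char_sum sum_distrib_left mult.assoc)
    also have "(\<lambda>\<tau>. \<Sum>j\<in>S. \<Sum>l<k. freq (\<tau> j) l * x j l) = (\<lambda>\<tau>. \<Sum>j<k. \<Sum>l<k. \<xi> \<tau> j l * x j l)"
      using S by (intro ext sum.mono_neutral_cong_left) (auto simp: \<xi>_def)
    finally show ?thesis .
  qed
  have "(\<Sum>x\<in>sols. \<Prod>j\<in>S. complex_of_real (g c (x j))) =
      (\<Sum>\<tau>\<in>S \<rightarrow>\<^sub>E \<Omega>. w \<tau> * (\<Sum>x\<in>sols. add_char p (\<Sum>j<k. \<Sum>l<k. \<xi> \<tau> j l * x j l)))"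
    unfolding expand sum_distrib_left by (rule sum.swap)
  also have "\<dots> = (\<Sum>\<tau>\<in>S \<rightarrow>\<^sub>E \<Omega>. if resonant S \<tau> then of_nat (card sols) * w \<tau> else 0)"
  proof -
    have res: "(\<forall>l<k. pluecker p k X Y (\<lambda>j. \<xi> \<tau> j l)) \<longleftrightarrow> resonant S \<tau>" for \<tau>
      by (simp add: resonant_def \<xi>_def)
    show ?thesis
      unfolding sum_add_char_solutions2[OF p_prime 01 D01] res by (intro sum.cong refl) simp
  qed
  also have "\<dots> = of_nat (card sols) * (\<Sum>\<tau> | \<tau> \<in> S \<rightarrow>\<^sub>E \<Omega> \<and> resonant S \<tau>. w \<tau>)"
    unfolding sum_distrib_left by (rule sum.inter_filter[OF finite_PiE_\<Omega>[OF finS], symmetric])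
  finally show ?thesis unfolding w_def .
qed

text \<open>If \<open>a\<close> and \<open>b\<close> carry frequency 0, the relation on
  \<open>a\<close>, \<open>b\<close>, \<open>l\<close> reduces to one term and forces the frequency
  at \<open>l\<close> to vanish; but its first two coordinates form a column up to sign.\<close>

lemma not_resonant:
  assumes ab: "a < k" "b < k" "a \<noteq> b" "a \<notin> S" "b \<notin> S" and l: "l \<in> S" "l < k"
    and \<tau>: "\<tau> \<in> S \<rightarrow>\<^sub>E \<Omega>"
  shows "\<not> resonant S \<tau>"
proof
  assume "resonant S \<tau>"
  then have *: "int p dvd freq (\<tau> l) c * det2 X Y a b" if "c < k" for c
    using that ab l unfolding resonant_def pluecker_def by (fastforce simp: cong_0_iff)
  have "int p dvd freq (\<tau> l) c" if "c < k" for c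
    using *[OF that] p_dvd_det2_iff[OF ab(1,2)] ab(3) by (simp add: p_dvd_mult_iff)
  from this[of 0] this[of 1]
  have "int p dvd snd (snd (\<tau> l)) * X (fst (\<tau> l))" "int p dvd snd (snd (\<tau> l)) * Y (fst (\<tau> l))"
    using k_ge by (simp_all add: freq_def)
  moreover have "\<tau> l \<in> \<Omega>" using \<tau> l by auto
  ultimately have "int p dvd snd (snd (\<tau> l))" "snd (snd (\<tau> l)) \<in> {1, - 1}"
    using col_nonzero_mod_p \<Omega>D by blast+
  then show False using prime_int_p by (auto simp: not_prime_unit)
qed

text \<open>Since \<open>k\<close> and \<open>card S\<close> are even, \<open>S\<close> misses at
  least two indices, so \<open>not_resonant\<close> leaves no tuple.\<close>

lemma sum_prod_g_eq_0:
  assumes "S \<subseteq> {..<k}" "S \<noteq> {}" "even (card S)" "S \<noteq> {..<k}"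
  shows "(\<Sum>x\<in>sols. \<Prod>j\<in>S. g c (x j)) = 0"
proof -
  have "card S < k" using psubset_card_mono[of "{..<k}" S] assms by auto
  then have "card S + 2 \<le> k" using assms(3) k_even by presburger
  then have "card ({..<k} - S) \<ge> 2"
    using assms(1) by (simp add: card_Diff_subset finite_subset)
  then have "\<not> card ({..<k} - S) \<le> Suc 0" by simp
  then obtain a b where ab: "a \<in> {..<k} - S" "b \<in> {..<k} - S" "a \<noteq> b"
    using card_le_Suc0_iff_eq[of "{..<k} - S"] by blast
  obtain l where l: "l \<in> S" "l < k" using assms by auto
  have no: "{\<tau>. \<tau> \<in> S \<rightarrow>\<^sub>E \<Omega> \<and> resonant S \<tau>} = {}"
    using not_resonant[of a b S l] ab l by blast
  have "complex_of_real (\<Sum>x\<in>sols. \<Prod>j\<in>S. g c (x j)) = 0"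
    using sum_prod_g[OF assms(1), of c] unfolding no by simp
  then show ?thesis using of_real_eq_0_iff by blast
qed

text \<open>The tuples that survive both averages: the solutions enforce resonance, and
  \<open>c\<close> enforces total phase 0 modulo \<open>p\<close>.\<close>

definition T :: "(nat \<Rightarrow> nat \<times> (nat \<Rightarrow> int) \<times> int) set" where
  "T = {\<tau> \<in> {..<k} \<rightarrow>\<^sub>E \<Omega>. resonant {..<k} \<tau> \<and> int p dvd (\<Sum>j<k. phase (\<tau> j))}"

lemma finite_T: "finite T"
  by (simp add: T_def finite_PiE_\<Omega>)

lemma sum_sum_prod_g:
  "(\<Sum>c\<in>{0..<int p}. \<Sum>x\<in>sols. \<Prod>j<k. g c (x j)) =
    p * card sols * (\<Sum>\<tau>\<in>T. \<Prod>j<k. sgn_at (fst (\<tau> j)))"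
proof -
  define R where "R = {\<tau>. \<tau> \<in> {..<k} \<rightarrow>\<^sub>E \<Omega> \<and> resonant {..<k} \<tau>}"
  have finR: "finite R" by (simp add: R_def finite_PiE_\<Omega>)
  have T: "T = {\<tau> \<in> R. int p dvd (\<Sum>j<k. phase (\<tau> j))}"
    unfolding T_def R_def by blast
  have "complex_of_real (\<Sum>c\<in>{0..<int p}. \<Sum>x\<in>sols. \<Prod>j<k. g c (x j)) =
    (\<Sum>c\<in>{0..<int p}. of_nat (card sols) * (\<Sum>\<tau>\<in>R.
      (\<Prod>j<k. of_real (sgn_at (fst (\<tau> j)))) * add_char p (c * (\<Sum>j<k. phase (\<tau> j)))))"
    using sum_prod_g[of "{..<k}"] by (simp add: R_def)
  also have "\<dots> = of_nat (card sols) * (\<Sum>\<tau>\<in>R. (\<Prod>j<k. of_real (sgn_at (fst (\<tau> j)))) *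
      (\<Sum>c\<in>{0..<int p}. add_char p (c * (\<Sum>j<k. phase (\<tau> j)))))"
    unfolding sum_distrib_left[symmetric] by (subst sum.swap) (simp only: sum_distrib_left)
  also have "\<dots> = of_nat (card sols) * (\<Sum>\<tau>\<in>R. if int p dvd (\<Sum>j<k. phase (\<tau> j))
      then (\<Prod>j<k. of_real (sgn_at (fst (\<tau> j)))) * of_nat p else 0)"
    unfolding sum_add_char[OF p_pos] by (simp only: if_distrib[of "\<lambda>t. _ * t"] mult_zero_right)
  also have "\<dots> = of_nat (card sols) * (\<Sum>\<tau>\<in>T. (\<Prod>j<k. of_real (sgn_at (fst (\<tau> j)))) * of_nat p)"
    unfolding T sum.inter_filter[OF finR] ..
  also have "\<dots> = complex_of_real (p * card sols * (\<Sum>\<tau>\<in>T. \<Prod>j<k. sgn_at (fst (\<tau> j))))"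
    by (simp add: sum_distrib_left sum_distrib_right mult_ac)
  finally show ?thesis using of_real_eq_iff by blast
qed


section \<open>Resonant tuples with a repeated index\<close>

lemma resonant_eqs:
  assumes "resonant {..<k} \<tau>" "a < k" "b < k" "c < k" "l < k"
  shows "int p dvd freq (\<tau> a) l * det2 X Y b c + freq (\<tau> b) l * det2 X Y c a +
    freq (\<tau> c) l * det2 X Y a b"
  using assms unfolding resonant_def pluecker_def by (auto simp: cong_0_iff)

text \<open>Resonance in coordinates 0 and 1 gives a linear map of the plane modulo \<open>p\<close>
  that sends each column \<open>j\<close> to the column \<open>fst (\<tau> j)\<close> up to sign. If
  two independent columns go to one line, the whole plane does, and distinct columns span distinct
  lines.\<close>

lemma resonant_same_index:
  assumes res: "resonant {..<k} \<tau>" and \<tau>: "\<tau> \<in> {..<k} \<rightarrow>\<^sub>E \<Omega>"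
    and abc: "a < k" "b < k" "c < k" "a \<noteq> b" and eq: "fst (\<tau> b) = fst (\<tau> a)"
  shows "fst (\<tau> c) = fst (\<tau> a)"
proof -
  define \<epsilon> where "\<epsilon> j = snd (snd (\<tau> j))" for j
  define i where "i j = fst (\<tau> j)" for j
  have 01: "0 < k" "1 < k" using k_ge by simp_all
  have in_\<Omega>: "\<tau> j \<in> \<Omega>" if "j < k" for j using \<tau> that by auto
  have "int p dvd Y (i a) * (\<epsilon> a * X (i a) * det2 X Y b c + \<epsilon> b * X (i a) * det2 X Y c a +
      \<epsilon> c * X (i c) * det2 X Y a b)"
    using resonant_eqs[OF res abc(1-3) 01(1)] eq by (simp add: freq_def \<epsilon>_def i_def)
  moreover have "int p dvd X (i a) * (\<epsilon> a * Y (i a) * det2 X Y b c + \<epsilon> b * Y (i a) * det2 X Y c a +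
      \<epsilon> c * Y (i c) * det2 X Y a b)"
    using resonant_eqs[OF res abc(1-3) 01(2)] eq by (simp add: freq_def \<epsilon>_def i_def)
  ultimately have "int p dvd Y (i a) * (\<epsilon> a * X (i a) * det2 X Y b c + \<epsilon> b * X (i a) * det2 X Y c a +
      \<epsilon> c * X (i c) * det2 X Y a b) - X (i a) * (\<epsilon> a * Y (i a) * det2 X Y b c +
      \<epsilon> b * Y (i a) * det2 X Y c a + \<epsilon> c * Y (i c) * det2 X Y a b)"
    by (rule dvd_diff)
  also have "\<dots> = \<epsilon> c * (det2 X Y a b * det2 X Y (i c) (i a))"
    unfolding det2_def[of X Y "i c" "i a"] by (simp add: algebra_simps)
  finally have "int p dvd det2 X Y a b * det2 X Y (i c) (i a)"
    using \<Omega>D(3)[OF in_\<Omega>[OF abc(3)]] by (auto simp: \<epsilon>_def)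
  then have "int p dvd det2 X Y (i c) (i a)"
    using p_dvd_det2_iff[OF abc(1,2)] abc(4) by (simp add: p_dvd_mult_iff)
  then show ?thesis
    using p_dvd_det2_iff \<Omega>D(1)[OF in_\<Omega>] abc by (simp add: i_def)
qed

text \<open>For constant index the relations in coordinates 0 and 1 are this expression times column
  \<open>i\<close>, which is nonzero modulo \<open>p\<close>. Three terms of size at most
  \<open>M\<close> stay below \<open>p\<close>, so the congruence is an equality.\<close>

lemma signs_affine:
  assumes res: "resonant {..<k} \<tau>" and i: "i < k" "\<And>j. j < k \<Longrightarrow> fst (\<tau> j) = i"
    and \<epsilon>: "\<And>j. j < k \<Longrightarrow> snd (snd (\<tau> j)) = \<epsilon> j" "\<And>j. j < k \<Longrightarrow> \<epsilon> j \<in> {1, - 1}"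
    and abc: "a < k" "b < k" "c < k"
  shows "\<epsilon> a * det2 X Y b c + \<epsilon> b * det2 X Y c a + \<epsilon> c * det2 X Y a b = 0" (is "?t = 0")
proof (rule eq_0_if_p_dvd)
  have 01: "0 < k" "1 < k" using k_ge by simp_all
  have "int p dvd ?t * X i"
    using resonant_eqs[OF res abc 01(1)] i \<epsilon>(1) abc by (simp add: freq_def algebra_simps)
  moreover have "int p dvd ?t * Y i"
    using resonant_eqs[OF res abc 01(2)] i \<epsilon>(1) abc by (simp add: freq_def algebra_simps)
  ultimately show "int p dvd ?t"
    using col_nonzero_mod_p[OF i(1)] by blast
  have le: "\<bar>\<epsilon> a * det2 X Y b c\<bar> \<le> M" if "a < k" "b < k" "c < k" for a b c
    using \<epsilon>(2)[OF that(1)] det2_le[OF that(2,3)] by (auto simp: abs_mult)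
  show "\<bar>?t\<bar> < int p"
    using le[OF abc] le[OF abc(2,3,1)] le[OF abc(3,1,2)] p_gt(1) by linarith
qed

lemma lagrange_weight_ndvd:
  assumes "i < k"
  shows "\<not> int p dvd lagrange_weight X Y k i"
  using assms unfolding lagrange_weight_def
  by (auto simp: prime_dvd_prod_iff[OF _ prime_int_p] p_dvd_det2_iff)

lemma d_even: "even d"
  using k_even by simp

lemma eps_power_d: "\<epsilon> \<in> {1, - 1 :: int} \<Longrightarrow> \<epsilon> ^ d = 1"
  using d_even by auto

section \<open>Counting tuples with constant index\<close>

definition T_const :: "nat \<Rightarrow> (nat \<Rightarrow> int) \<Rightarrow> (nat \<Rightarrow> nat \<times> (nat \<Rightarrow> int) \<times> int) set" where
  "T_const i \<epsilon> = {\<tau> \<in> T. \<forall>j<k. fst (\<tau> j) = i \<and> snd (snd (\<tau> j)) = \<epsilon> j}"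

text \<open>By resonance the last coordinates at columns 0 and 1 determine those at all other
  columns, so a tuple is encoded by \<open>d\<close> points of the plane; its phase condition says
  that they are a zero of a multilinear form, which \<open>form_product_nonzero\<close> shows to be
  nonzero.\<close>

lemma T_const_bound:
  assumes i: "i < k" and \<epsilon>: "\<And>j. j < k \<Longrightarrow> \<epsilon> j \<in> {1, - 1}"
  shows "p * card (T_const i \<epsilon>) \<le> d * p ^ (2 * d)"
proof (cases "T_const i \<epsilon> = {}")
  case True
  then show ?thesis by simp
next
  case False
  then obtain \<tau>\<^sub>0 where "\<tau>\<^sub>0 \<in> T_const i \<epsilon>" by blast
  then have \<tau>0: "resonant {..<k} \<tau>\<^sub>0" "\<And>j. j < k \<Longrightarrow> fst (\<tau>\<^sub>0 j) = i"
      "\<And>j. j < k \<Longrightarrow> snd (snd (\<tau>\<^sub>0 j)) = \<epsilon> j"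
    by (auto simp: T_const_def T_def)
  have 01: "0 < k" "1 < k" using k_ge by simp_all
  have D01: "\<not> int p dvd det2 X Y 0 1" using p_dvd_det2_iff[OF 01] by simp
  \<comment> \<open>By Cramer's rule, \<open>A j\<close> and \<open>B j\<close> express the signed
    value at column \<open>j\<close>, times \<open>det2 X Y 0 1\<close>, through the values at
    columns 0 and 1.\<close>
  define A B where "A j = \<epsilon> 0 * det2 X Y j 1" and "B j = \<epsilon> 1 * det2 X Y 0 j" for j
  obtain \<sigma> where \<sigma>: "\<And>t. t < d \<Longrightarrow> \<sigma> t < k"
      "\<not> int p dvd (\<Sum>j<k. \<epsilon> j * (\<Prod>t<d. det2 X Y (\<sigma> t) j))"
    using form_product_nonzero[of k X Y M p \<epsilon>] k_ge det2_nonzero det2_le p_gt(2) \<epsilon>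
      signs_affine[OF \<tau>0(1) i \<tau>0(2,3) \<epsilon>] by force
  \<comment> \<open>The values that the linear form \<open>det2 X Y (\<sigma> t)\<close> takes at
    columns 0 and 1, with signs that cancel those in \<open>A\<close> and \<open>B\<close>.\<close>
  define \<mu> where "\<mu> t = (\<epsilon> 0 * det2 X Y (\<sigma> t) 0, \<epsilon> 1 * det2 X Y (\<sigma> t) 1)" for t
  have "A j * fst (\<mu> t) + B j * snd (\<mu> t) = det2 X Y 0 1 * det2 X Y (\<sigma> t) j" for j t
  proof -
    have "A j * fst (\<mu> t) + B j * snd (\<mu> t) = (\<epsilon> 0 * \<epsilon> 0) * (det2 X Y j 1 * det2 X Y (\<sigma> t) 0) +
        (\<epsilon> 1 * \<epsilon> 1) * (det2 X Y 0 j * det2 X Y (\<sigma> t) 1)"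
      by (simp add: A_def B_def \<mu>_def algebra_simps)
    moreover have "\<epsilon> 0 * \<epsilon> 0 = 1" "\<epsilon> 1 * \<epsilon> 1 = 1" using \<epsilon>[OF 01(1)] \<epsilon>[OF 01(2)] by auto
    ultimately show ?thesis by (simp add: det2_def algebra_simps)
  qed
  then have "form_product {..<k} A B \<epsilon> d \<mu> =
      det2 X Y 0 1 ^ d * (\<Sum>j<k. \<epsilon> j * (\<Prod>t<d. det2 X Y (\<sigma> t) j))"
    by (simp add: form_product_def prod.distrib sum_distrib_left algebra_simps)
  then have nz: "\<not> int p dvd form_product {..<k} A B \<epsilon> d \<mu>"
    using D01 \<sigma>(2) prime_dvd_power[OF prime_int_p] by (auto simp: p_dvd_mult_iff)
  define Z where "Z = {h \<in> {..<d} \<rightarrow>\<^sub>E {0..<int p} \<times> {0..<int p}.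
      int p dvd form_product {..<k} A B \<epsilon> d h}"
  define F where "F \<tau> = (\<lambda>t\<in>{..<d}. (fst (snd (\<tau> 0)) t, fst (snd (\<tau> 1)) t))"
    for \<tau> :: "nat \<Rightarrow> nat \<times> (nat \<Rightarrow> int) \<times> int"
  have mem: "\<tau> \<in> {..<k} \<rightarrow>\<^sub>E \<Omega>" "resonant {..<k} \<tau>" "int p dvd (\<Sum>j<k. phase (\<tau> j))"
      "\<And>j. j < k \<Longrightarrow> fst (\<tau> j) = i" "\<And>j. j < k \<Longrightarrow> snd (snd (\<tau> j)) = \<epsilon> j"
    if "\<tau> \<in> T_const i \<epsilon>" for \<tau>
    using that by (auto simp: T_const_def T_def)
  have mem_E: "fst (snd (\<tau> j)) \<in> E" if "\<tau> \<in> T_const i \<epsilon>" "j < k" for \<tau> j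
    using \<Omega>D(2) PiE_mem[OF mem(1)[OF that(1)]] that(2) by blast
  have rel: "int p dvd A j * fst (F \<tau> t) + B j * snd (F \<tau> t) - det2 X Y 0 1 * (\<epsilon> j * fst (snd (\<tau> j)) t)"
    if \<tau>: "\<tau> \<in> T_const i \<epsilon>" and jt: "j < k" "t < d" for \<tau> j t
  proof -
    have l: "t + 2 < k" using jt by simp
    have "int p dvd \<epsilon> 0 * fst (snd (\<tau> 0)) t * det2 X Y 1 j + \<epsilon> 1 * fst (snd (\<tau> 1)) t * det2 X Y j 0 +
        \<epsilon> j * fst (snd (\<tau> j)) t * det2 X Y 0 1"
      using resonant_eqs[OF mem(2)[OF \<tau>] 01 jt(1) l] mem(5)[OF \<tau>] 01 jt by (simp add: freq_def)
    then have "int p dvd - (\<epsilon> 0 * fst (snd (\<tau> 0)) t * det2 X Y 1 j +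
        \<epsilon> 1 * fst (snd (\<tau> 1)) t * det2 X Y j 0 + \<epsilon> j * fst (snd (\<tau> j)) t * det2 X Y 0 1)"
      by (simp only: dvd_minus_iff)
    then show ?thesis
      using jt by (simp add: A_def B_def F_def det2_def algebra_simps)
  qed
  have "card (T_const i \<epsilon>) \<le> card Z"
  proof (rule card_inj_on_le[where f = F])
    show "inj_on F (T_const i \<epsilon>)"
    proof (rule inj_onI)
      fix \<tau> \<tau>' assume \<tau>: "\<tau> \<in> T_const i \<epsilon>" and \<tau>': "\<tau>' \<in> T_const i \<epsilon>" and eq: "F \<tau> = F \<tau>'"
      have "fst (snd (\<tau> j)) t = fst (snd (\<tau>' j)) t" if jt: "j < k" "t < d" for j t
      proof (rule eq_if_dvd_diff)
        have "int p dvd (A j * fst (F \<tau> t) + B j * snd (F \<tau> t) - det2 X Y 0 1 * (\<epsilon> j * fst (snd (\<tau>' j)) t)) -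
            (A j * fst (F \<tau> t) + B j * snd (F \<tau> t) - det2 X Y 0 1 * (\<epsilon> j * fst (snd (\<tau> j)) t))"
          using rel[OF \<tau> jt] rel[OF \<tau>' jt] unfolding eq by (rule dvd_diff[rotated])
        then have "int p dvd det2 X Y 0 1 * (\<epsilon> j * (fst (snd (\<tau> j)) t - fst (snd (\<tau>' j)) t))"
          by (simp add: algebra_simps)
        then have "int p dvd \<epsilon> j * (fst (snd (\<tau> j)) t - fst (snd (\<tau>' j)) t)"
          unfolding p_dvd_mult_iff[of "det2 X Y 0 1"] using D01 by blast
        moreover have "\<not> int p dvd \<epsilon> j"
          using \<epsilon>[OF jt(1)] prime_int_p by (auto simp: not_prime_unit)
        ultimately show "int p dvd fst (snd (\<tau> j)) t - fst (snd (\<tau>' j)) t"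
          unfolding p_dvd_mult_iff[of "\<epsilon> j"] by blast
        show "fst (snd (\<tau> j)) t \<in> {0..<int p}" "fst (snd (\<tau>' j)) t \<in> {0..<int p}"
          using PiE_mem[OF mem_E[OF \<tau> jt(1), unfolded E_def], of t]
            PiE_mem[OF mem_E[OF \<tau>' jt(1), unfolded E_def], of t] jt(2) by simp_all
      qed
      then have "fst (snd (\<tau> j)) = fst (snd (\<tau>' j))" if "j < k" for j
        by (rule PiE_ext[OF mem_E[OF \<tau> that, unfolded E_def] mem_E[OF \<tau>' that, unfolded E_def]])
          (simp_all add: that)
      then have "\<tau> j = \<tau>' j" if "j \<in> {..<k}" for j
        using that mem(4,5)[OF \<tau>] mem(4,5)[OF \<tau>'] by (simp add: prod_eq_iff)
      then show "\<tau> = \<tau>'"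
        by (rule PiE_ext[OF mem(1)[OF \<tau>] mem(1)[OF \<tau>']])
    qed
    show "F ` T_const i \<epsilon> \<subseteq> Z"
    proof (rule image_subsetI)
      fix \<tau> assume \<tau>: "\<tau> \<in> T_const i \<epsilon>"
      have "F \<tau> \<in> {..<d} \<rightarrow>\<^sub>E {0..<int p} \<times> {0..<int p}"
        using PiE_mem[OF mem_E[OF \<tau> 01(1), unfolded E_def]] PiE_mem[OF mem_E[OF \<tau> 01(2), unfolded E_def]]
        unfolding F_def restrict_PiE_iff by simp
      moreover have "int p dvd form_product {..<k} A B \<epsilon> d (F \<tau>)"
      proof -
        have "[form_product {..<k} A B \<epsilon> d (F \<tau>) =
            (\<Sum>j<k. \<epsilon> j * (\<Prod>t<d. det2 X Y 0 1 * (\<epsilon> j * fst (snd (\<tau> j)) t)))] (mod int p)"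
          unfolding form_product_def
          by (intro cong_sum cong_scalar_left cong_prod) (use rel[OF \<tau>] in \<open>simp add: cong_iff_dvd_diff\<close>)
        \<comment> \<open>The \<open>d\<close> copies of the sign \<open>\<epsilon> j\<close> inside
          the product cancel because \<open>d\<close> is even.\<close>
        also have "(\<Sum>j<k. \<epsilon> j * (\<Prod>t<d. det2 X Y 0 1 * (\<epsilon> j * fst (snd (\<tau> j)) t))) =
            det2 X Y 0 1 ^ d * (\<Sum>j<k. \<epsilon> j * (\<Prod>t<d. fst (snd (\<tau> j)) t))"
          unfolding sum_distrib_left
          by (intro sum.cong refl) (use eps_power_d[OF \<epsilon>] in \<open>simp add: prod.distrib algebra_simps\<close>)
        finally have c: "[form_product {..<k} A B \<epsilon> d (F \<tau>) =
            det2 X Y 0 1 ^ d * (\<Sum>j<k. \<epsilon> j * (\<Prod>t<d. fst (snd (\<tau> j)) t))] (mod int p)" .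
        \<comment> \<open>As the index is constant, all phases share one Lagrange weight, which is
          invertible modulo \<open>p\<close>.\<close>
        have "(\<Sum>j<k. phase (\<tau> j)) =
            lagrange_weight X Y k i * (\<Sum>j<k. \<epsilon> j * (\<Prod>t<d. fst (snd (\<tau> j)) t))"
          unfolding sum_distrib_left phase_def using mem(4,5)[OF \<tau>] by (intro sum.cong refl) simp
        then have "int p dvd (\<Sum>j<k. \<epsilon> j * (\<Prod>t<d. fst (snd (\<tau> j)) t))"
          using mem(3)[OF \<tau>] lagrange_weight_ndvd[OF i] by (simp add: p_dvd_mult_iff)
        then show ?thesis using c by (simp add: cong_dvd_iff)
      qed
      ultimately show "F \<tau> \<in> Z" by (simp add: Z_def)
    qed
    show "finite Z" unfolding Z_def by (simp add: finite_PiE)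
  qed
  then have "p * card (T_const i \<epsilon>) \<le> p * card Z" by simp
  also have "\<dots> \<le> d * p ^ (2 * d)"
    unfolding Z_def by (rule card_form_product_zeros[OF p_prime nz])
  finally show ?thesis .
qed

section \<open>Counting tuples with permuted indices\<close>

definition T_inj :: "(nat \<Rightarrow> nat \<times> (nat \<Rightarrow> int) \<times> int) set" where
  "T_inj = {\<tau> \<in> T. inj_on (\<lambda>j. fst (\<tau> j)) {..<k}}"

text \<open>Tuples with index \<open>j\<close> and sign 1 at position \<open>j\<close> suffice: each
  \<open>h\<close> prescribes \<open>d\<close> linear forms, whose values at the columns are the
  last coordinates. They are resonant by construction, and their total phase vanishes by
  \<open>lagrange_int\<close>.\<close>

lemma card_T_inj: "card T_inj \<ge> p ^ (2 * d)"
proof -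
  define P where "P = {..<d} \<rightarrow>\<^sub>E {0..<int p} \<times> {0..<int p}"
  define s where "s h j = (\<lambda>t\<in>{..<d}. (fst (h t) * X j + snd (h t) * Y j) mod int p)"
    for h :: "nat \<Rightarrow> int \<times> int" and j
  define F where "F h = (\<lambda>j\<in>{..<k}. (j, s h j, 1 :: int))" for h
  have 01: "0 < k" "1 < k" using k_ge by simp_all
  have D01: "\<not> int p dvd det2 X Y 0 1" using p_dvd_det2_iff[OF 01] by simp
  have "F h \<in> T_inj" for h
  proof -
    have "s h j \<in> E" for j
      unfolding s_def E_def restrict_PiE_iff using p_pos by simp
    then have 1: "F h \<in> {..<k} \<rightarrow>\<^sub>E \<Omega>"
      unfolding F_def restrict_PiE_iff by (simp add: \<Omega>_def)
    have 2: "resonant {..<k} (F h)"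
      unfolding resonant_def pluecker_def
    proof (intro allI impI)
      fix l a b c assume *: "l < k" "a < k" "b < k" "c < k"
      obtain \<alpha> \<beta> where cong: "[freq (F h j) l = \<alpha> * X j + \<beta> * Y j] (mod int p)" if "j < k" for j
      proof -
        consider "l = 0" | "l = 1" | "l \<ge> 2" by linarith
        then show ?thesis
        proof cases
          case 1 then show ?thesis using that[of 1 0] by (simp add: F_def freq_def)
        next
          case 2 then show ?thesis using that[of 0 1] by (simp add: F_def freq_def)
        next
          case 3 then show ?thesis
            using that[of "fst (h (l - 2))" "snd (h (l - 2))"] *(1)
            by (simp add: F_def freq_def s_def cong_def)
        qed
      qed
      have "[freq (F h a) l * det2 X Y b c + freq (F h b) l * det2 X Y c a + freq (F h c) l * det2 X Y a b =
          (\<alpha> * X a + \<beta> * Y a) * det2 X Y b c + (\<alpha> * X b + \<beta> * Y b) * det2 X Y c a +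
          (\<alpha> * X c + \<beta> * Y c) * det2 X Y a b] (mod int p)"
        using * by (intro cong_add cong_scalar_right cong)
      also have "(\<alpha> * X a + \<beta> * Y a) * det2 X Y b c + (\<alpha> * X b + \<beta> * Y b) * det2 X Y c a +
          (\<alpha> * X c + \<beta> * Y c) * det2 X Y a b = 0"
        by (simp add: det2_def algebra_simps)
      finally show "[(if a \<in> {..<k} then freq (F h a) l else 0) * det2 X Y b c +
          (if b \<in> {..<k} then freq (F h b) l else 0) * det2 X Y c a +
          (if c \<in> {..<k} then freq (F h c) l else 0) * det2 X Y a b = 0] (mod int p)"
        using * by simp
    qed
    have "(\<Sum>j<k. phase (F h j)) = (\<Sum>j<k. lagrange_weight X Y k j * (\<Prod>t<d. s h j t))"
      by (intro sum.cong refl) (simp add: phase_def F_def)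
    also have "[\<dots> = (\<Sum>j<k. lagrange_weight X Y k j * (\<Prod>t<d. fst (h t) * X j + snd (h t) * Y j))] (mod int p)"
      by (intro cong_sum cong_scalar_left cong_prod) (simp add: s_def cong_def)
    also have "(\<Sum>j<k. lagrange_weight X Y k j * (\<Prod>t<d. fst (h t) * X j + snd (h t) * Y j)) = 0"
      using lagrange_int[of k X Y "\<lambda>t. fst (h t)" "\<lambda>t. snd (h t)"] k_ge det2_nonzero by simp
    finally have 3: "int p dvd (\<Sum>j<k. phase (F h j))" by (simp add: cong_0_iff)
    show ?thesis
      using 1 2 3 unfolding T_inj_def T_def by (auto simp: F_def intro!: inj_onI)
  qed
  moreover have "inj_on F P"
  proof (rule inj_onI)
    fix h h' assume h: "h \<in> P" "h' \<in> P" "F h = F h'"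
    have "h t = h' t" if t: "t < d" for t
    proof -
      \<comment> \<open>A linear form modulo \<open>p\<close> is determined by its values at columns
        0 and 1, whose minor is invertible.\<close>
      have dvd: "int p dvd (fst (h t) - fst (h' t)) * X j + (snd (h t) - snd (h' t)) * Y j" if "j < k" for j
      proof -
        have "s h j t = s h' j t" using fun_cong[OF h(3), of j] that by (simp add: F_def)
        then have "int p dvd (fst (h t) * X j + snd (h t) * Y j) - (fst (h' t) * X j + snd (h' t) * Y j)"
          using t by (simp add: s_def mod_eq_dvd_iff)
        then show ?thesis by (simp add: algebra_simps)
      qed
      have "int p dvd ((fst (h t) - fst (h' t)) * X 0 + (snd (h t) - snd (h' t)) * Y 0) * Y 1 -
          ((fst (h t) - fst (h' t)) * X 1 + (snd (h t) - snd (h' t)) * Y 1) * Y 0"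
        by (rule dvd_diff[OF dvd_mult2[OF dvd[OF 01(1)]] dvd_mult2[OF dvd[OF 01(2)]]])
      then have "int p dvd (fst (h t) - fst (h' t)) * det2 X Y 0 1"
        by (simp add: det2_def algebra_simps)
      then have fst: "int p dvd fst (h t) - fst (h' t)" using D01 by (simp add: p_dvd_mult_iff)
      have "int p dvd ((fst (h t) - fst (h' t)) * X 1 + (snd (h t) - snd (h' t)) * Y 1) * X 0 -
          ((fst (h t) - fst (h' t)) * X 0 + (snd (h t) - snd (h' t)) * Y 0) * X 1"
        by (rule dvd_diff[OF dvd_mult2[OF dvd[OF 01(2)]] dvd_mult2[OF dvd[OF 01(1)]]])
      then have "int p dvd (snd (h t) - snd (h' t)) * det2 X Y 0 1"
        by (simp add: det2_def algebra_simps)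
      then have snd: "int p dvd snd (h t) - snd (h' t)" using D01 by (simp add: p_dvd_mult_iff)
      have "h t \<in> {0..<int p} \<times> {0..<int p}" "h' t \<in> {0..<int p} \<times> {0..<int p}"
        using h(1,2) t unfolding P_def by blast+
      then show ?thesis
        using eq_if_dvd_diff[OF fst] eq_if_dvd_diff[OF snd] by (auto simp: prod_eq_iff mem_Times_iff)
    qed
    then show "h = h'"
      using PiE_ext[OF h(1,2)[unfolded P_def]] by blast
  qed
  ultimately have "card P \<le> card T_inj"
    using finite_T by (intro card_inj_on_le[of F]) (auto simp: T_inj_def)
  then show ?thesis
    by (simp add: P_def card_PiE power_mult power2_eq_square power_mult_distrib)
qed

lemma T_dichotomy: "T - T_inj \<subseteq> (\<Union>i<k. \<Union>\<epsilon>\<in>{..<k} \<rightarrow>\<^sub>E {1, - 1}. T_const i \<epsilon>)"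
proof
  fix \<tau> assume "\<tau> \<in> T - T_inj"
  then have \<tau>: "\<tau> \<in> T" "\<tau> \<in> {..<k} \<rightarrow>\<^sub>E \<Omega>" "resonant {..<k} \<tau>" "\<not> inj_on (\<lambda>j. fst (\<tau> j)) {..<k}"
    by (auto simp: T_def T_inj_def)
  then obtain a b where ab: "a < k" "b < k" "a \<noteq> b" "fst (\<tau> b) = fst (\<tau> a)"
    by (auto simp: inj_on_def)
  define \<epsilon> where "\<epsilon> = (\<lambda>j\<in>{..<k}. snd (snd (\<tau> j)))"
  have in_\<Omega>: "\<tau> j \<in> \<Omega>" if "j < k" for j using \<tau>(2) that by auto
  have "fst (\<tau> j) = fst (\<tau> a)" if "j < k" for j
    using resonant_same_index[OF \<tau>(3,2) ab(1,2) that ab(3,4)] .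
  then have "\<tau> \<in> T_const (fst (\<tau> a)) \<epsilon>"
    using \<tau>(1) by (simp add: T_const_def \<epsilon>_def)
  moreover have "\<epsilon> \<in> {..<k} \<rightarrow>\<^sub>E {1, - 1}"
    unfolding \<epsilon>_def restrict_PiE_iff using \<Omega>D(3)[OF in_\<Omega>] by blast
  moreover have "fst (\<tau> a) < k" using \<Omega>D(1)[OF in_\<Omega>[OF ab(1)]] .
  ultimately show "\<tau> \<in> (\<Union>i<k. \<Union>\<epsilon>\<in>{..<k} \<rightarrow>\<^sub>E {1, - 1}. T_const i \<epsilon>)" by blast
qed

lemma card_not_T_inj: "card (T - T_inj) < p ^ (2 * d)"
proof -
  define S where "S = {..<k} \<rightarrow>\<^sub>E {1, - 1 :: int}"
  have finS: "finite S" and cardS: "card S = 2 ^ k"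
    by (simp_all add: S_def finite_PiE card_PiE numeral_2_eq_2)
  have fin: "finite (T_const i \<epsilon>)" for i \<epsilon>
    using finite_T by (simp add: T_const_def)
  have "card (T - T_inj) \<le> card (\<Union>i<k. \<Union>\<epsilon>\<in>S. T_const i \<epsilon>)"
    using T_dichotomy fin finS by (intro card_mono) (auto simp: S_def)
  also have "\<dots> \<le> (\<Sum>i<k. card (\<Union>\<epsilon>\<in>S. T_const i \<epsilon>))"
    by (rule card_UN_le) simp
  also have "\<dots> \<le> (\<Sum>i<k. \<Sum>\<epsilon>\<in>S. card (T_const i \<epsilon>))"
    by (intro sum_mono card_UN_le finS)
  finally have "p * card (T - T_inj) \<le> (\<Sum>i<k. \<Sum>\<epsilon>\<in>S. p * card (T_const i \<epsilon>))"
    by (simp add: sum_distrib_left[symmetric])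
  also have "\<dots> \<le> (\<Sum>i<k. \<Sum>\<epsilon>\<in>S. d * p ^ (2 * d))"
  proof (intro sum_mono)
    fix i \<epsilon> assume "i \<in> {..<k}" "\<epsilon> \<in> S"
    then show "p * card (T_const i \<epsilon>) \<le> d * p ^ (2 * d)"
      by (intro T_const_bound) (auto simp: S_def)
  qed
  also have "\<dots> = (k * 2 ^ k * d) * p ^ (2 * d)"
    by (simp add: cardS)
  also have "\<dots> < p * p ^ (2 * d)"
    using p_gt(3) p_pos by (intro mult_strict_right_mono) auto
  finally show ?thesis by simp
qed

section \<open>Sign of the weighted count\<close>

lemma prod_sgn_at_le: "(\<Prod>j<k. sgn_at (i j)) \<le> 1"
proof -
  have "\<bar>\<Prod>j<k. sgn_at (i j)\<bar> = 1"
    unfolding abs_prod by (intro prod.neutral) (simp add: sgn_at_def)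
  then show ?thesis by simp
qed

text \<open>An injective index map is a permutation, so it meets the single negative index 0 exactly
  once.\<close>

lemma prod_sgn_at_T_inj:
  assumes "\<tau> \<in> T_inj"
  shows "(\<Prod>j<k. sgn_at (fst (\<tau> j))) = - 1"
proof -
  have \<tau>: "inj_on (\<lambda>j. fst (\<tau> j)) {..<k}" "\<tau> \<in> {..<k} \<rightarrow>\<^sub>E \<Omega>"
    using assms by (auto simp: T_inj_def T_def)
  have "(\<lambda>j. fst (\<tau> j)) ` {..<k} \<subseteq> {..<k}"
    using \<Omega>D(1)[OF PiE_mem[OF \<tau>(2)]] by blast
  then have "bij_betw (\<lambda>j. fst (\<tau> j)) {..<k} {..<k}"
    using \<tau>(1) by (simp add: bij_betw_def endo_inj_surj)
  then have "(\<Prod>j<k. sgn_at (fst (\<tau> j))) = (\<Prod>i<k. sgn_at i)"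
    by (rule prod.reindex_bij_betw)
  also have "\<dots> = - 1"
    using k_ge by (simp add: sgn_at_def prod.delta)
  finally show ?thesis .
qed

lemma sum_T_neg: "(\<Sum>\<tau>\<in>T. \<Prod>j<k. sgn_at (fst (\<tau> j))) < 0"
proof -
  have sub: "T_inj \<subseteq> T" by (auto simp: T_inj_def)
  have "(\<Sum>\<tau>\<in>T. \<Prod>j<k. sgn_at (fst (\<tau> j))) =
      (\<Sum>\<tau>\<in>T - T_inj. \<Prod>j<k. sgn_at (fst (\<tau> j))) + (\<Sum>\<tau>\<in>T_inj. \<Prod>j<k. sgn_at (fst (\<tau> j)))"
    by (rule sum.subset_diff[OF sub finite_T])
  also have "\<dots> \<le> (\<Sum>\<tau>\<in>T - T_inj. 1) + (\<Sum>\<tau>\<in>T_inj. - 1)"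
    by (intro add_mono sum_mono prod_sgn_at_le) (simp add: prod_sgn_at_T_inj)
  also have "\<dots> < 0"
    using card_not_T_inj card_T_inj by simp
  finally show ?thesis .
qed

text \<open>The total over all residues \<open>c\<close> is a positive multiple of the weighted
  count, hence negative.\<close>

lemma ex_g_neg: "\<exists>c. (\<Sum>x\<in>sols. \<Prod>j<k. g c (x j)) < 0"
proof (rule ccontr)
  assume "\<not> ?thesis"
  then have "(\<Sum>c\<in>{0..<int p}. \<Sum>x\<in>sols. \<Prod>j<k. g c (x j)) \<ge> 0"
    by (intro sum_nonneg[of "{0..<int p}"]) (meson not_less)
  moreover have "card sols > 0"
    using solutions2_nonempty[OF p_pos] finite_solutions2 by (simp add: card_gt_0_iff)
  then have "real (p * card sols) * (\<Sum>\<tau>\<in>T. \<Prod>j<k. sgn_at (fst (\<tau> j))) < 0"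
    using sum_T_neg p_pos by (intro mult_pos_neg) simp_all
  ultimately show False
    using sum_sum_prod_g by simp
qed

section \<open>Perturbing the constant function one half\<close>

lemma sum_prod_half_add:
  fixes \<eta> :: real
  shows "(\<Sum>x\<in>sols. \<Prod>j<k. 1 / 2 + \<eta> * g c (x j)) + (\<Sum>x\<in>sols. \<Prod>j<k. 1 / 2 - \<eta> * g c (x j)) =
    2 * (1 / 2) ^ k * card sols + 2 * \<eta> ^ k * (\<Sum>x\<in>sols. \<Prod>j<k. g c (x j))"
proof -
  define G where "G S = (\<Sum>x\<in>sols. \<Prod>j\<in>S. g c (x j))" for S
  have expand: "(\<Sum>x\<in>sols. \<Prod>j<k. 1 / 2 + \<theta> * g c (x j)) =
      (\<Sum>S\<in>Pow {..<k}. \<theta> ^ card S * (1 / 2) ^ card ({..<k} - S) * G S)" for \<theta> :: real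
  proof -
    have "(\<Prod>j<k. 1 / 2 + \<theta> * g c (x j)) =
        (\<Sum>S\<in>Pow {..<k}. \<theta> ^ card S * (1 / 2) ^ card ({..<k} - S) * (\<Prod>j\<in>S. g c (x j)))" for x
    proof -
      have "(\<Prod>j<k. \<theta> * g c (x j) + 1 / 2) =
          (\<Sum>S\<in>Pow {..<k}. (\<Prod>j\<in>S. \<theta> * g c (x j)) * (\<Prod>j\<in>{..<k} - S. 1 / 2))"
        by (rule prod_add) simp
      then show ?thesis by (simp add: prod.distrib add.commute mult_ac)
    qed
    then show ?thesis
      unfolding G_def sum_distrib_left by (simp only:) (rule sum.swap)
  qed
  have "(\<Sum>x\<in>sols. \<Prod>j<k. 1 / 2 + \<eta> * g c (x j)) + (\<Sum>x\<in>sols. \<Prod>j<k. 1 / 2 + - \<eta> * g c (x j)) =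
      (\<Sum>S\<in>Pow {..<k}. (\<eta> ^ card S + (- \<eta>) ^ card S) * (1 / 2) ^ card ({..<k} - S) * G S)"
    unfolding expand sum.distrib[symmetric] by (simp only: distrib_right)
  \<comment> \<open>Odd sizes cancel between \<open>\<eta>\<close> and \<open>- \<eta>\<close>;
    proper nonempty sets of even size vanish by \<open>sum_prod_g_eq_0\<close>.\<close>
  also have "\<dots> = (\<Sum>S\<in>{{}, {..<k}}. (\<eta> ^ card S + (- \<eta>) ^ card S) * (1 / 2) ^ card ({..<k} - S) * G S)"
  proof (rule sum.mono_neutral_right)
    show "\<forall>S\<in>Pow {..<k} - {{}, {..<k}}.
        (\<eta> ^ card S + (- \<eta>) ^ card S) * (1 / 2) ^ card ({..<k} - S) * G S = 0"
    proof
      fix S assume S: "S \<in> Pow {..<k} - {{}, {..<k}}"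
      show "(\<eta> ^ card S + (- \<eta>) ^ card S) * (1 / 2) ^ card ({..<k} - S) * G S = 0"
      proof (cases "even (card S)")
        case True
        then have "G S = 0" unfolding G_def using S by (intro sum_prod_g_eq_0) auto
        then show ?thesis by simp
      next
        case False
        then show ?thesis by simp
      qed
    qed
  qed auto
  also have "\<dots> = 2 * (1 / 2) ^ k * card sols + 2 * \<eta> ^ k * G {..<k}"
  proof -
    have "{} \<noteq> {..<k}" using k_ge by (metis lessThan_empty_iff bot_nat_def not_numeral_le_zero)
    then show ?thesis using k_even by (simp add: G_def)
  qed
  finally show ?thesis by (simp add: G_def)
qed

theorem ex_uncommon_function:
  "\<exists>f \<in> UNIV \<rightarrow> {0..1 :: real}. (\<Sum>x\<in>sols. \<Prod>j<k. f (x j)) + (\<Sum>x\<in>sols. \<Prod>j<k. 1 - f (x j)) <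
    2 * (1 / 2) ^ k * card sols"
proof -
  obtain c where c: "(\<Sum>x\<in>sols. \<Prod>j<k. g c (x j)) < 0" using ex_g_neg by blast
  \<comment> \<open>\<open>N\<close> bounds \<open>g\<close> by \<open>g_abs_le\<close>, so the
    perturbation by \<open>\<eta> * g c\<close> stays within one half.\<close>
  define N where "N = real (2 * k * p ^ d)"
  have N: "N > 0" using k_ge p_pos by (simp add: N_def)
  define \<eta> where "\<eta> = 1 / (2 * N)"
  have \<eta>: "\<eta> > 0" using N by (simp add: \<eta>_def)
  define f where "f x = 1 / 2 + \<eta> * g c x" for x
  have "\<bar>\<eta> * g c x\<bar> \<le> 1 / 2" for x
    using g_abs_le[of c x, folded N_def] N by (simp add: \<eta>_def abs_mult field_simps)
  then have "f x \<in> {0..1}" for x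
    unfolding f_def atLeastAtMost_iff by (smt (verit) field_sum_of_halves)
  moreover have "(\<Sum>x\<in>sols. \<Prod>j<k. f (x j)) + (\<Sum>x\<in>sols. \<Prod>j<k. 1 - f (x j)) =
      2 * (1 / 2) ^ k * card sols + 2 * \<eta> ^ k * (\<Sum>x\<in>sols. \<Prod>j<k. g c (x j))"
  proof -
    have "1 - f x = 1 / 2 - \<eta> * g c x" for x by (simp add: f_def)
    then show ?thesis unfolding f_def by (simp only: sum_prod_half_add)
  qed
  moreover have "2 * \<eta> ^ k * (\<Sum>x\<in>sols. \<Prod>j<k. g c (x j)) < 0"
    using \<eta> c by (intro mult_pos_neg) simp_all
  ultimately show ?thesis by (intro bexI[of _ f]) auto
qed

end

section \<open>Girth\<close>

lemma mem_row_span_iff: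
  assumes L: "L \<in> carrier_mat 2 k"
  shows "v \<in> row_span L \<longleftrightarrow>
    (\<exists>\<alpha> \<beta>. v = vec k (\<lambda>j. \<alpha> * of_int (L $$ (0, j)) + \<beta> * of_int (L $$ (1, j))))"
proof -
  have A: "rat_mat L \<in> carrier_mat 2 k" using L by (simp add: rat_mat_def)
  have dims: "dim_row (rat_mat L) = 2" "dim_col (rat_mat L) = k" "dim_col L = k" using A L by auto
  have mult: "(rat_mat L)\<^sup>T *\<^sub>v y =
      vec k (\<lambda>j. y $ 0 * of_int (L $$ (0, j)) + y $ 1 * of_int (L $$ (1, j)))"
    if "y \<in> carrier_vec 2" for y
    using that L
    by (intro eq_vecI) (auto simp: rat_mat_def scalar_prod_def numeral_2_eq_2 mult.commute)
  have "v \<in> row_span L \<longleftrightarrow> (\<exists>y\<in>carrier_vec 2. (rat_mat L)\<^sup>T *\<^sub>v y = v)"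
    unfolding row_span_def dims vec_space.row_space_eq[OF A] by (auto simp: mult)
  also have "\<dots> \<longleftrightarrow> (\<exists>\<alpha> \<beta>. v = vec k (\<lambda>j. \<alpha> * of_int (L $$ (0, j)) + \<beta> * of_int (L $$ (1, j))))"
  proof
    assume "\<exists>y\<in>carrier_vec 2. (rat_mat L)\<^sup>T *\<^sub>v y = v"
    then obtain y where "y \<in> carrier_vec 2" "(rat_mat L)\<^sup>T *\<^sub>v y = v" by blast
    then show "\<exists>\<alpha> \<beta>. v = vec k (\<lambda>j. \<alpha> * of_int (L $$ (0, j)) + \<beta> * of_int (L $$ (1, j)))"
      using mult[of y] by metis
  next
    assume "\<exists>\<alpha> \<beta>. v = vec k (\<lambda>j. \<alpha> * of_int (L $$ (0, j)) + \<beta> * of_int (L $$ (1, j)))"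
    then obtain \<alpha> \<beta> where v: "v = vec k (\<lambda>j. \<alpha> * of_int (L $$ (0, j)) + \<beta> * of_int (L $$ (1, j)))"
      by blast
    define y where "y = vec 2 (\<lambda>i. if i = 0 then \<alpha> else \<beta>)"
    have y: "y \<in> carrier_vec 2" by (simp add: y_def)
    then have "(rat_mat L)\<^sup>T *\<^sub>v y = v" unfolding v mult[OF y] by (simp add: y_def)
    then show "\<exists>y\<in>carrier_vec 2. (rat_mat L)\<^sup>T *\<^sub>v y = v" using y by blast
  qed
  finally show ?thesis .
qed

lemma det2_parallel_trans:
  assumes "det2 X Y a i = 0" "det2 X Y a j = 0" "X a \<noteq> 0 \<or> Y a \<noteq> 0"
  shows "det2 X Y i j = 0"
proof -
  have "X a * det2 X Y i j = X i * det2 X Y a j - X j * det2 X Y a i"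
    "Y a * det2 X Y i j = Y i * det2 X Y a j - Y j * det2 X Y a i"
    by (simp_all add: det2_def algebra_simps)
  then show ?thesis using assms by auto
qed

text \<open>If columns \<open>a\<close> and \<open>b\<close> are parallel, the vector
  \<open>det2 X Y a\<close> of the row span vanishes at both, so it is zero or has support at most
  \<open>k - 2\<close>. If it is zero, all columns are parallel and every nonzero vector of the row
  span has full support. Neither fits girth \<open>k - 1\<close>.\<close>

lemma girth_det2_nonzero:
  fixes L :: "int mat"
  defines "X \<equiv> \<lambda>j. L $$ (0, j)" and "Y \<equiv> \<lambda>j. L $$ (1, j)"
  assumes L: "L \<in> carrier_mat 2 k" and k: "k \<ge> 4" and girth: "girth L = k - 1"
    and cols: "\<And>j. j < k \<Longrightarrow> col L j \<noteq> 0\<^sub>v 2"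
    and ab: "a < k" "b < k" "a \<noteq> b"
  shows "det2 X Y a b \<noteq> 0"
proof
  assume D: "det2 X Y a b = 0"
  have col: "X j \<noteq> 0 \<or> Y j \<noteq> 0" if "j < k" for j
  proof (rule ccontr)
    assume "\<not> ?thesis"
    then have "col L j = 0\<^sub>v 2"
      using L that by (intro eq_vecI) (auto simp: X_def Y_def less_2_cases_iff)
    then show False using cols that by blast
  qed
  define K where "K = {card (supp_vec v) | v. v \<in> row_span L \<and> v \<noteq> 0\<^sub>v (dim_col L)}"
  have girth_K: "Inf K = k - 1" using girth by (simp add: girth_def K_def)
  have in_K: "card {j. j < k \<and> \<alpha> * of_int (X j) + \<beta> * of_int (Y j) \<noteq> 0} \<in> K"
    if "l < k" "\<alpha> * of_int (X l) + \<beta> * of_int (Y l) \<noteq> 0" for \<alpha> \<beta> :: rat and l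
  proof -
    define v where "v = vec k (\<lambda>j. \<alpha> * of_int (X j) + \<beta> * of_int (Y j))"
    have "v \<in> row_span L" unfolding mem_row_span_iff[OF L] v_def X_def Y_def by blast
    moreover have "v \<noteq> 0\<^sub>v (dim_col L)"
    proof
      assume "v = 0\<^sub>v (dim_col L)"
      then have "v $ l = 0" using L that by simp
      then show False using that by (simp add: v_def)
    qed
    moreover have "supp_vec v = {j. j < k \<and> \<alpha> * of_int (X j) + \<beta> * of_int (Y j) \<noteq> 0}"
      by (auto simp: supp_vec_def v_def)
    ultimately show ?thesis unfolding K_def by (intro CollectI exI[of _ v]) simp
  qed
  show False
  proof (cases "\<exists>l<k. det2 X Y a l \<noteq> 0")
    case True
    then obtain l where l: "l < k" "det2 X Y a l \<noteq> 0" by blast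
    have eq: "- of_int (Y a) * of_int (X j) + of_int (X a) * of_int (Y j) = rat_of_int (det2 X Y a j)" for j
      by (simp add: det2_def)
    have "card {j. j < k \<and> rat_of_int (det2 X Y a j) \<noteq> 0} \<in> K"
      using in_K[of l "- of_int (Y a)" "of_int (X a)"] l unfolding eq by simp
    moreover have "card {j. j < k \<and> rat_of_int (det2 X Y a j) \<noteq> 0} \<le> card ({..<k} - {a, b})"
      using D by (intro card_mono) auto
    moreover have "card ({..<k} - {a, b}) = k - 2" using ab by (simp add: card_Diff_subset)
    ultimately have "Inf K \<le> k - 2"
      using wellorder_Inf_le1[of "card {j. j < k \<and> rat_of_int (det2 X Y a j) \<noteq> 0}" K] by linarith
    then show False using girth_K k by simp
  next
    case False
    then have par: "det2 X Y i j = 0" if "i < k" "j < k" for i j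
      using det2_parallel_trans[of X Y a i j] col[OF ab(1)] that by blast
    \<comment> \<open>Combining the rows with coefficients \<open>X a\<close> and \<open>Y a\<close>
      gives a sum of squares at \<open>a\<close>, hence a nonzero vector; so the infimum is
      attained.\<close>
    have "of_int (X a) * of_int (X a) + of_int (Y a) * of_int (Y a) \<noteq> (0 :: rat)"
      using col[OF ab(1)] by (simp add: sum_squares_eq_zero_iff)
    then have "K \<noteq> {}" using in_K[OF ab(1)] by blast
    then have "k - 1 \<in> K" using Inf_nat_def1 girth_K by metis
    then obtain v where v: "v \<in> row_span L" "v \<noteq> 0\<^sub>v k" "card (supp_vec v) = k - 1"
      using L by (auto simp: K_def)
    then obtain \<alpha> \<beta> where v_eq: "v = vec k (\<lambda>j. \<alpha> * of_int (X j) + \<beta> * of_int (Y j))"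
      unfolding mem_row_span_iff[OF L] X_def Y_def by blast
    have "v $ j \<noteq> 0" if j: "j < k" for j
    proof
      assume "v $ j = 0"
      then have 0: "\<alpha> * of_int (X j) + \<beta> * of_int (Y j) = 0" using j by (simp add: v_eq)
      have "v $ i = 0" if i: "i < k" for i
      proof -
        have ij: "rat_of_int (X i) * of_int (Y j) = of_int (X j) * of_int (Y i)"
          using par[OF i j] unfolding det2_def by (metis eq_iff_diff_eq_0 of_int_mult)
        have "of_int (X j) * (\<alpha> * of_int (X i) + \<beta> * of_int (Y i)) =
            of_int (X i) * (\<alpha> * of_int (X j) + \<beta> * of_int (Y j))"
          using ij by (simp add: algebra_simps)
        moreover have "of_int (Y j) * (\<alpha> * of_int (X i) + \<beta> * of_int (Y i)) =
            of_int (Y i) * (\<alpha> * of_int (X j) + \<beta> * of_int (Y j))"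
          using ij by (simp add: algebra_simps)
        ultimately have "\<alpha> * of_int (X i) + \<beta> * of_int (Y i) = 0"
          using 0 col[OF j] by auto
        then show ?thesis using i by (simp add: v_eq)
      qed
      then have "v = 0\<^sub>v k" by (intro eq_vecI) (auto simp: v_eq)
      then show False using v(2) by blast
    qed
    then have "supp_vec v = {..<k}" by (auto simp: supp_vec_def v_eq)
    then show False using v(3) k by simp
  qed
qed

lemma solutions_eq_solutions2:
  assumes "L \<in> carrier_mat 2 k"
  shows "solutions p n L = solutions2 p n k (\<lambda>j. L $$ (0, j)) (\<lambda>j. L $$ (1, j))"
  using assms unfolding solutions_def solutions2_def by (auto simp: less_2_cases_iff)

theorem theorem1p8:
  fixes k :: nat and L :: "int mat"
  assumes "k \<ge> 4" and "even k"
    and "L \<in> carrier_mat 2 k"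
    and "irredundant L"
    and "girth L = k - 1"
  shows "\<exists>p\<^sub>L :: nat. \<forall>p :: nat. prime p \<and> p \<ge> p\<^sub>L \<longrightarrow> uncommon_over p L"
proof -
  define X Y where "X j = L $$ (0, j)" and "Y j = L $$ (1, j)" for j
  have cols: "col L j \<noteq> 0\<^sub>v 2" if "j < k" for j
    using assms(3,4) that unfolding irredundant_def by auto
  have D: "det2 X Y i j \<noteq> 0" if "i < k" "j < k" "i \<noteq> j" for i j
    unfolding X_def Y_def using girth_det2_nonzero[OF assms(3,1,5) cols that] .
  \<comment> \<open>A sum of nonnegative terms, which bounds each of them.\<close>
  define M where "M = (\<Sum>i<k. \<Sum>j<k. \<bar>det2 X Y i j\<bar>)"
  have M: "\<bar>det2 X Y i j\<bar> \<le> M" if "i < k" "j < k" for i j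
  proof -
    have "\<bar>det2 X Y i j\<bar> \<le> (\<Sum>j<k. \<bar>det2 X Y i j\<bar>)"
      using that by (intro member_le_sum) auto
    also have "\<dots> \<le> M"
      unfolding M_def using that by (intro member_le_sum[of i "{..<k}" "\<lambda>i. \<Sum>j<k. \<bar>det2 X Y i j\<bar>"])
        (auto intro: sum_nonneg)
    finally show ?thesis .
  qed
  \<comment> \<open>Adding up the three lower bounds on \<open>p\<close> required by
    \<open>generic_system\<close>, plus 1, makes each inequality strict.\<close>
  define p\<^sub>L where "p\<^sub>L = nat (3 * M) + nat (2 * M ^ (k - 2)) + k * 2 ^ k * (k - 2) + 1"
  have "uncommon_over p L" if p: "prime p" "p \<ge> p\<^sub>L" for p
  proof -
    have gt: "int p > 3 * M" "int p > 2 * M ^ (k - 2)" "p > k * 2 ^ k * (k - 2)"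
      using p(2) unfolding p\<^sub>L_def by linarith+
    interpret generic_system X Y k p M
      using assms(1,2) p(1) D M gt by unfold_locales
    \<comment> \<open>The dimension is \<open>n = k\<close>: two coordinates for a column and
      \<open>k - 2\<close> for the parameter \<open>s\<close>.\<close>
    have sols: "solutions p k L = sols"
      unfolding X_def Y_def by (rule solutions_eq_solutions2[OF assms(3)])
    have dim: "dim_col L = k" using assms(3) by auto
    obtain f where f: "f \<in> UNIV \<rightarrow> {0..1 :: real}"
      "(\<Sum>x\<in>sols. \<Prod>j<k. f (x j)) + (\<Sum>x\<in>sols. \<Prod>j<k. 1 - f (x j)) < 2 * (1 / 2) ^ k * card sols"
      using ex_uncommon_function by blast
    have card: "real (card sols) > 0"
      using solutions2_nonempty[OF p_pos] finite_solutions2 by (simp add: card_gt_0_iff)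
    have "sol_density p k L f + sol_density p k L (\<lambda>v. 1 - f v) < 2 * (1 / 2) ^ k"
      unfolding sol_density_def dim sols add_divide_distrib[symmetric]
      using f(2) card by (simp add: divide_less_eq)
    also have "2 * (1 / 2) ^ k = (2 :: real) powi (1 - int k)"
      by (simp add: power_int_diff power_divide)
    finally have "\<not> 2 powi (1 - int (dim_col L)) \<le> sol_density p k L f + sol_density p k L (\<lambda>v. 1 - f v)"
      by (simp add: dim)
    moreover have "f \<in> Fp_space p k \<rightarrow> {0..1}" using f(1) by auto
    ultimately show ?thesis unfolding uncommon_over_def common_over_def by blast
  qed
  then show ?thesis by blast
qed

end
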